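(* Let $a,b$ be real numbers. For $n\ge1$, the element of $\mathbf{Sym}_{n+1}$ defined by $$D_{a,b}^{n+1}=\sum_{\varepsilon=(\eta_1)^{n_1}\cdots(\eta_s)^{n_s}}\Bigl(\prod_{\eta_i=+,\ i<s}a\Bigr)\Bigl(\prod_{\eta_i=-,\ i<s}b\Bigr)\,\mathrm{ca}_{n_1}(a,b)\cdots\mathrm{ca}_{n_s}(a,b)\;R_{\varepsilon\bullet}$$ is primitive. Here the sum is over all sequences of signs $\varepsilon\in\{+,-\}^n$, each written in its minimal decomposition into stacks of identical signs: $\varepsilon=(\eta_1)^{n_1}\cdots(\eta_s)^{n_s}$ with $\eta_i\ne\eta_{i+1}$, $n_i\ge1$ and $n_1+\dots+n_s=n$.
   Context: Noncommutative symmetric functions: $\mathbf{Sym}$ is the free associative algebra $\mathbb{R}\langle S_1,S_2,\dots\rangle$, graded by $\deg S_n=n$ (with homogeneous components $\mathbf{Sym}_n$), with coproduct (an algebra morphism) $\Delta S_n=\sum_{k=0}^nS_k\otimes S_{n-k}$, $S_0=1$. An element $D$ is primitive if $\Delta D=D\otimes1+1\otimes D$. For a composition $I=(i_1,\dots,i_r)$ of $n$, put $\ell(I)=r$, $S^I=S_{i_1}\cdots S_{i_r}$, $\mathrm{Des}(I)=\{i_1,i_1+i_2,\dots,i_1+\dots+i_{r-1}\}$; for compositions of the same integer, $J\le I$ means $\mathrm{Des}(J)\subseteq\mathrm{Des}(I)$. The ribbon basis $(R_I)$ is defined by $S^I=\sum_{J\le I}R_J$. For $\varepsilon\in\{+,-\}^n$,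 $R_{\varepsilon\bullet}=(-1)^{\ell(I)-1}R_I$, where $I$ is the composition of $n+1$ with $\mathrm{Des}(I)=\{i:\varepsilon_i=-\}$. Polynomials $\mathrm{ca}_n(a,b)$ are defined by the generating series $$\mathrm{ca}(a,b,t)=\frac{1-(a+b)t-\sqrt{1-2(a+b)t+(b-a)^2t^2}}{2abt}=\sum_{n\ge1}\mathrm{ca}_n(a,b)\,t^n,$$ expanded as a formal power series in $t$ with $a,b$ indeterminates; equivalently $\mathrm{ca}_n(a,b)=\sum_{i=0}^{n-1}T(n,i+1)a^ib^{n-1-i}$ with $T(n,k)=\frac1k\binom{n-1}{k-1}\binom{n}{k-1}$. So $\mathrm{ca}_1=1$, $\mathrm{ca}_2=a+b$, $\mathrm{ca}_3=a^2+3ab+b^2$. *)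

theory Defs
  imports Complex_Main "HOL-Library.Poly_Mapping" "HOL-Library.Product_Plus"
    "HOL-Computational_Algebra.Polynomial"
    "HOL-Computational_Algebra.Formal_Power_Series"
begin

text \<open>
  For a (not necessarily commutative) additively written monoid \<open>'a\<close>, the type
  \<open>'a \<Rightarrow>\<^sub>0 real\<close> with its library multiplication (convolution) is the monoid algebra of \<open>'a\<close>.
  The library provides the ring structure; the scalar multiplication is added here.
\<close>

instantiation poly_mapping :: (type, real_vector) real_vector
begin

definition scaleR_poly_mapping :: "real \<Rightarrow> ('a \<Rightarrow>\<^sub>0 'b) \<Rightarrow> 'a \<Rightarrow>\<^sub>0 'b"
  where "scaleR_poly_mapping c f = Poly_Mapping.map (scaleR c) f"

lemma lookup_scaleR: "Poly_Mapping.lookup (c *\<^sub>R f) k = c *\<^sub>R Poly_Mapping.lookup (f :: 'a \<Rightarrow>\<^sub>0 'b) k"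
  by (simp add: scaleR_poly_mapping_def map.rep_eq when_def)

instance
  by standard
    (auto intro!: poly_mapping_eqI simp: lookup_scaleR lookup_add scaleR_add_right scaleR_add_left)

end

lemma scaleR_single [simp]: "c *\<^sub>R Poly_Mapping.single k x = Poly_Mapping.single k (c *\<^sub>R x)"
  by (auto intro!: poly_mapping_eqI simp: lookup_scaleR lookup_single when_def)

lemma poly_mapping_eq_sum_single:
  fixes f :: "'a \<Rightarrow>\<^sub>0 'b :: comm_monoid_add"
  shows "f = (\<Sum>k\<in>Poly_Mapping.keys f. Poly_Mapping.single k (Poly_Mapping.lookup f k))"
proof (rule poly_mapping_eqI)
  fix k
  have "Poly_Mapping.lookup (\<Sum>k\<in>Poly_Mapping.keys f. Poly_Mapping.single k (Poly_Mapping.lookup f k)) k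
      = (\<Sum>j\<in>Poly_Mapping.keys f. if j = k then Poly_Mapping.lookup f k else 0)"
    unfolding lookup_sum by (rule sum.cong) (auto simp: lookup_single when_def)
  also have "\<dots> = Poly_Mapping.lookup f k"
    by (auto simp: in_keys_iff)
  finally show "Poly_Mapping.lookup f k = Poly_Mapping.lookup (\<Sum>k\<in>Poly_Mapping.keys f. Poly_Mapping.single k (Poly_Mapping.lookup f k)) k" ..
qed

lemma poly_mapping_linear_induct [case_names zero single add]:
  fixes f :: "'a \<Rightarrow>\<^sub>0 'b :: comm_monoid_add"
  assumes "P 0" "\<And>k c. P (Poly_Mapping.single k c)" "\<And>f g. P f \<Longrightarrow> P g \<Longrightarrow> P (f + g)"
  shows "P f"
proof -
  have "P (\<Sum>k\<in>K. Poly_Mapping.single k (Poly_Mapping.lookup f k))" if "finite K" for K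
    using that by induction (auto intro: assms)
  from this[of "Poly_Mapping.keys f"] show ?thesis
    by (metis finite_keys poly_mapping_eq_sum_single)
qed

instance poly_mapping :: (monoid_add, real_algebra_1) real_algebra_1
proof
  fix c :: real and f g :: "'a \<Rightarrow>\<^sub>0 'b"
  have single: "(c *\<^sub>R Poly_Mapping.single k x) * g = c *\<^sub>R (Poly_Mapping.single k x * g)"
    for k x and g :: "'a \<Rightarrow>\<^sub>0 'b"
    by (induction g rule: poly_mapping_linear_induct)
      (simp_all add: mult_single distrib_left scaleR_add_right del: scaleR_single,
       simp add: mult_single)
  show "(c *\<^sub>R f) * g = c *\<^sub>R (f * g)"
    by (induction f rule: poly_mapping_linear_induct)
      (simp_all add: single distrib_right scaleR_add_right del: scaleR_single)
  have single': "f * (c *\<^sub>R Poly_Mapping.single k x) = c *\<^sub>R (f * Poly_Mapping.single k x)"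
    for k x and f :: "'a \<Rightarrow>\<^sub>0 'b"
    by (induction f rule: poly_mapping_linear_induct)
      (simp_all add: mult_single distrib_right scaleR_add_right del: scaleR_single,
       simp add: mult_single)
  show "f * (c *\<^sub>R g) = c *\<^sub>R (f * g)"
    by (induction g rule: poly_mapping_linear_induct)
      (simp_all add: single' distrib_left scaleR_add_right del: scaleR_single)
qed


typedef composition = "{I :: nat list. 0 \<notin> set I}"
  morphisms parts composition_of
  by (rule exI[of _ "[]"]) simp

lemma parts_pos: "0 \<notin> set (parts I)"
  using parts[of I] by simp

lemma parts_composition_of [simp]: "0 \<notin> set I \<Longrightarrow> parts (composition_of I) = I"
  by (simp add: composition_of_inverse)

text \<open>
  Under concatenation compositions form the free monoid on the positive integers; it is written
  additively because the monoid algebra construction requires this.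
\<close>

instantiation composition :: monoid_add
begin

definition zero_composition :: composition
  where "0 = composition_of []"

definition plus_composition :: "composition \<Rightarrow> composition \<Rightarrow> composition"
  where "I + J = composition_of (parts I @ parts J)"

lemma parts_zero [simp]: "parts 0 = []"
  by (simp add: zero_composition_def)

lemma parts_plus [simp]: "parts (I + J) = parts I @ parts J"
  by (simp add: plus_composition_def parts_pos)

instance
  by standard (simp_all flip: parts_inject)

end

definition weight :: "composition \<Rightarrow> nat"
  where "weight I = sum_list (parts I)"

definition Des :: "composition \<Rightarrow> nat set"
  where "Des I = (\<lambda>k. sum_list (take k (parts I))) ` {1..<length (parts I)}"

definition coarser :: "composition \<Rightarrow> composition \<Rightarrow> bool"  (infix \<open>\<preceq>\<close> 50)
  where "J \<preceq> I \<longleftrightarrow> weight J = weight I \<and> Des J \<subseteq> Des I"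

lemma image_take_Cons_Cons:
  "(\<lambda>k. sum_list (take k (x # y # ys))) ` {1..<length (x # y # ys)}
    = insert x ((+) (x :: nat) ` (\<lambda>k. sum_list (take k (y # ys))) ` {1..<length (y # ys)})"
proof -
  have *: "{1..<length (x # y # ys)} = insert 1 (Suc ` {1..<length (y # ys)})"
    by (auto simp: image_Suc_atLeastLessThan)
  show ?thesis
    unfolding * image_insert image_image by simp
qed

lemma Des_list_inj:
  fixes xs ys :: "nat list"
  assumes "0 \<notin> set xs" "0 \<notin> set ys" "sum_list xs = sum_list ys"
    and "(\<lambda>k. sum_list (take k xs)) ` {1..<length xs} = (\<lambda>k. sum_list (take k ys)) ` {1..<length ys}"
  shows "xs = ys"
  using assms
proof (induction xs arbitrary: ys)
  case Nil
  then show ?case by (cases ys) auto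
next
  case (Cons x xs)
  note prems = Cons.prems
  obtain y ys' where ys: "ys = y # ys'"
    using prems by (cases ys) auto
  let ?d = "\<lambda>xs. (\<lambda>k. sum_list (take k xs)) ` {1..<length (xs :: nat list)}"
  have pos: "0 < z" if "z \<in> ?d us" "0 \<notin> set us" for z us
    using that by (cases us) (auto simp: take_Cons split: nat.splits)
  show ?case
  proof (cases xs)
    case Nil
    then have "?d ys = {}" using prems by simp
    then have "ys' = []" using ys by (cases ys') auto
    then show ?thesis using Nil ys prems by simp
  next
    case xs: (Cons x' xs')
    have "?d (x # xs) \<noteq> {}" using xs by simp
    then have "?d ys \<noteq> {}" unfolding prems(4) .
    then obtain y' ys'' where ys': "ys' = y' # ys''" using ys by (cases ys') auto
    have dx: "?d (x # xs) = insert x ((+) x ` ?d xs)"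
      unfolding xs by (rule image_take_Cons_Cons)
    have dy: "?d ys = insert y ((+) y ` ?d ys')"
      unfolding ys ys' by (rule image_take_Cons_Cons)
    define U V where "U = ?d xs" and "V = ?d ys'"
    have U: "0 \<notin> U"
      using pos[of 0 xs] prems(1) by (auto simp only: U_def list.set insert_iff)
    have V: "0 \<notin> V"
      using pos[of 0 ys'] prems(2) ys by (auto simp only: V_def list.set insert_iff)
    have eq: "insert x ((+) x ` U) = insert y ((+) y ` V)"
      using prems(4) unfolding dx dy U_def V_def .
    have "x \<in> insert y ((+) y ` V)"
      using insertI1 unfolding eq[symmetric] .
    moreover have "y \<in> insert x ((+) x ` U)"
      using insertI1 unfolding eq .
    ultimately have xy: "x = y"
      by (elim insertE imageE) simp_all
    have "x \<notin> (+) x ` U" "x \<notin> (+) x ` V"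
      using U V by auto
    then have "(+) x ` U = (+) x ` V"
      using eq unfolding xy by (simp add: insert_ident)
    then have "U = V"
      by (simp add: inj_image_eq_iff)
    then have "?d xs = ?d ys'"
      unfolding U_def V_def .
    then have "xs = ys'"
      using Cons.IH[of ys'] prems xy ys by simp
    then show ?thesis using xy ys by simp
  qed
qed

lemma Des_inj: "weight I = weight J \<Longrightarrow> Des I = Des J \<Longrightarrow> I = J"
  by (metis Des_def Des_list_inj parts_inject parts_pos weight_def)

lemma finite_Des [simp]: "finite (Des I)"
  by (simp add: Des_def)

lemma Des_list_ex:
  fixes n :: nat
  assumes "A \<subseteq> {1..<n}" "n > 0"
  shows "\<exists>xs. 0 \<notin> set xs \<and> sum_list xs = n \<and> xs \<noteq> [] \<and>
    (\<lambda>k. sum_list (take k xs)) ` {1..<length xs} = A"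
  using assms
proof (induction n arbitrary: A rule: less_induct)
  case (less n)
  show ?case
  proof (cases "A = {}")
    case True
    then show ?thesis using less.prems by (intro exI[of _ "[n]"]) auto
  next
    case False
    have fin: "finite A" using less.prems finite_subset by blast
    define m where "m = Min A"
    have m: "m \<in> A" "\<And>x. x \<in> A \<Longrightarrow> m \<le> x"
      using False fin by (auto simp: m_def)
    then have mn: "0 < m" "m < n" using less.prems by force+
    define B where "B = (\<lambda>x. x - m) ` (A - {m})"
    have B: "B \<subseteq> {1..<n - m}"
      using less.prems m by (force simp: B_def)
    have AB: "A = insert m ((+) m ` B)"
      using m by (force simp: B_def image_image)
    obtain xs where xs: "0 \<notin> set xs" "sum_list xs = n - m" "xs \<noteq> []"
      "(\<lambda>k. sum_list (take k xs)) ` {1..<length xs} = B"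
      using less.IH[of "n - m" B] B mn by auto
    obtain y ys where ys: "xs = y # ys" using xs by (cases xs) auto
    have "(\<lambda>k. sum_list (take k (m # xs))) ` {1..<length (m # xs)} = A"
      unfolding AB xs(4)[symmetric] ys by (rule image_take_Cons_Cons)
    then show ?thesis using xs mn by (intro exI[of _ "m # xs"]) auto
  qed
qed

lemma composition_ex1:
  assumes "A \<subseteq> {1..<n}" "n > 0"
  shows "\<exists>!I. weight I = n \<and> Des I = A"
proof -
  obtain xs where "0 \<notin> set xs" "sum_list xs = n"
    "(\<lambda>k. sum_list (take k xs)) ` {1..<length xs} = A"
    using Des_list_ex[OF assms] by blast
  then have "weight (composition_of xs) = n \<and> Des (composition_of xs) = A"
    by (simp add: weight_def Des_def)
  then show ?thesis using Des_inj by blast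
qed

lemma finite_weight: "finite {I. weight I = n}"
proof (rule finite_imageD)
  have "parts ` {I. weight I = n} \<subseteq> {xs. set xs \<subseteq> {..n} \<and> length xs \<le> n}"
  proof (rule image_subsetI)
    fix I assume "I \<in> {I. weight I = n}"
    then have n: "sum_list (parts I) = n" by (simp add: weight_def)
    have "0 \<notin> set xs \<Longrightarrow> length xs \<le> sum_list xs" for xs :: "nat list"
      by (induction xs) auto
    from this[OF parts_pos] have "length (parts I) \<le> n"
      unfolding n[symmetric] .
    moreover have "set (parts I) \<subseteq> {..n}"
      unfolding n[symmetric] using member_le_sum_list by blast
    ultimately show "parts I \<in> {xs. set xs \<subseteq> {..n} \<and> length xs \<le> n}"
      by simp
  qed
  then show "finite (parts ` {I. weight I = n})"
    by (rule finite_subset) (rule finite_lists_length_le, simp)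
  show "inj_on parts {I. weight I = n}"
    by (simp add: inj_on_def parts_inject)
qed

lemma finite_coarser [simp]: "finite {J. J \<preceq> I}"
  by (rule finite_subset[OF _ finite_weight[of "weight I"]]) (auto simp: coarser_def)


text \<open>
  \<open>Sym\<close> is the monoid algebra of the free monoid on the positive integers, i.e. the free
  associative algebra; the monomial of a composition \<open>I\<close> is \<open>S\<^sup>I\<close>.  The monoid algebra of the
  direct product \<open>composition \<times> composition\<close> is the algebra \<open>Sym \<otimes> Sym\<close>, with \<open>(I, J)\<close> standing
  for \<open>S\<^sup>I \<otimes> S\<^sup>J\<close> and multiplication \<open>(u \<otimes> v) (u' \<otimes> v') = u u' \<otimes> v v'\<close> (lemma \<open>tensor_mult\<close>).
\<close>

type_synonym ncsf = "composition \<Rightarrow>\<^sub>0 real"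
type_synonym ncsf2 = "(composition \<times> composition) \<Rightarrow>\<^sub>0 real"

definition S_gen :: "nat \<Rightarrow> ncsf"
  where "S_gen n = (if n = 0 then 1 else Poly_Mapping.single (composition_of [n]) 1)"

definition S_prod :: "composition \<Rightarrow> ncsf"
  where "S_prod I = prod_list (map S_gen (parts I))"

lemma S_prod_eq_single: "S_prod I = Poly_Mapping.single I 1"
proof -
  have "0 \<notin> set xs \<Longrightarrow> prod_list (map S_gen xs) = Poly_Mapping.single (composition_of xs) 1" for xs
  proof (induction xs)
    case Nil
    then show ?case by (simp flip: zero_composition_def)
  next
    case (Cons x xs)
    then have "composition_of [x] + composition_of xs = composition_of (x # xs)"
      by (simp add: plus_composition_def)
    with Cons show ?case by (simp add: S_gen_def mult_single)
  qed
  then show ?thesis by (simp add: S_prod_def parts_pos parts_inverse)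
qed

definition Sym_comp :: "nat \<Rightarrow> ncsf set"
  where "Sym_comp n = {f. \<forall>I\<in>Poly_Mapping.keys f. weight I = n}"

definition tensor :: "ncsf \<Rightarrow> ncsf \<Rightarrow> ncsf2"  (infixr \<open>\<otimes>\<close> 75)
  where "f \<otimes> g = (\<Sum>I\<in>Poly_Mapping.keys f. \<Sum>J\<in>Poly_Mapping.keys g. Poly_Mapping.single (I, J) (Poly_Mapping.lookup f I * Poly_Mapping.lookup g J))"

lemma lookup_tensor: "Poly_Mapping.lookup (f \<otimes> g) p = Poly_Mapping.lookup f (fst p) * Poly_Mapping.lookup g (snd p)"
proof -
  obtain I J where p: "p = (I, J)" by (cases p)
  have "Poly_Mapping.lookup (f \<otimes> g) (I, J)
      = (\<Sum>I'\<in>Poly_Mapping.keys f. \<Sum>J'\<in>Poly_Mapping.keys g. if I' = I then if J' = J then Poly_Mapping.lookup f I * Poly_Mapping.lookup g J else 0 else 0)"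
    unfolding tensor_def lookup_sum
    by (intro sum.cong) (auto simp: lookup_single when_def)
  also have "\<dots> = (\<Sum>I'\<in>Poly_Mapping.keys f. if I' = I then Poly_Mapping.lookup f I * Poly_Mapping.lookup g J else 0)"
    by (intro sum.cong) (auto simp: in_keys_iff)
  also have "\<dots> = Poly_Mapping.lookup f I * Poly_Mapping.lookup g J"
    by (auto simp: in_keys_iff)
  finally show ?thesis by (simp add: p)
qed

lemma tensor_single: "Poly_Mapping.single I c \<otimes> Poly_Mapping.single J d = Poly_Mapping.single (I, J) (c * d)"
  by (rule poly_mapping_eqI) (auto simp: lookup_tensor lookup_single when_def)

lemma tensor_add_left: "(f + f') \<otimes> g = f \<otimes> g + f' \<otimes> g"
  and tensor_add_right: "f \<otimes> (g + g') = f \<otimes> g + f \<otimes> g'"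
  and tensor_zero_left [simp]: "0 \<otimes> g = 0"
  and tensor_zero_right [simp]: "f \<otimes> 0 = 0"
  and tensor_scaleR_left: "(c *\<^sub>R f) \<otimes> g = c *\<^sub>R (f \<otimes> g)"
  and tensor_scaleR_right: "f \<otimes> (c *\<^sub>R g) = c *\<^sub>R (f \<otimes> g)"
  by (simp_all add: poly_mapping_eq_iff fun_eq_iff lookup_tensor lookup_add lookup_scaleR algebra_simps)

lemma tensor_one_one [simp]: "1 \<otimes> 1 = 1"
  unfolding single_one[symmetric] tensor_single by (simp add: zero_prod_def)

lemma tensor_mult: "(f \<otimes> g) * (f' \<otimes> g') = (f * f') \<otimes> (g * g')"
proof (induction f rule: poly_mapping_linear_induct)
  case (single I c)
  show ?case
  proof (induction g rule: poly_mapping_linear_induct)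
    case (single J d)
    show ?case
    proof (induction f' rule: poly_mapping_linear_induct)
      case (single I' c')
      show ?case
        by (induction g' rule: poly_mapping_linear_induct)
          (simp_all add: tensor_single mult_single tensor_add_right distrib_left mult_ac)
    qed (simp_all add: tensor_add_left distrib_left)
  qed (simp_all add: tensor_add_right distrib_right)
qed (simp_all add: tensor_add_left distrib_right)

definition Delta_S :: "nat \<Rightarrow> ncsf2"
  where "Delta_S n = (\<Sum>k\<le>n. S_gen k \<otimes> S_gen (n - k))"

text \<open>
  The algebra morphism with \<open>\<Delta> S\<^sub>n = \<Sum>k\<le>n. S\<^sub>k \<otimes> S\<^sub>n\<^sub>-\<^sub>k\<close>, as the linear extension of
  its values on the basis \<open>S\<^sup>I\<close>; see the lemmas below.
\<close>

definition Delta :: "ncsf \<Rightarrow> ncsf2"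
  where "Delta f = (\<Sum>I\<in>Poly_Mapping.keys f. Poly_Mapping.lookup f I *\<^sub>R prod_list (map Delta_S (parts I)))"

lemma Delta_superset:
  assumes "finite K" "Poly_Mapping.keys f \<subseteq> K"
  shows "Delta f = (\<Sum>I\<in>K. Poly_Mapping.lookup f I *\<^sub>R prod_list (map Delta_S (parts I)))"
  unfolding Delta_def using assms
  by (intro sum.mono_neutral_left) (auto simp: in_keys_iff)

lemma Delta_zero [simp]: "Delta 0 = 0"
  by (simp add: Delta_def)

lemma Delta_add: "Delta (f + g) = Delta f + Delta g"
proof -
  let ?K = "Poly_Mapping.keys f \<union> Poly_Mapping.keys g"
  have "Poly_Mapping.keys (f + g) \<subseteq> ?K" by (rule keys_add)
  then show ?thesis
    by (simp add: Delta_superset[of ?K] lookup_add scaleR_add_left sum.distrib)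
qed

lemma Delta_scaleR: "Delta (c *\<^sub>R f) = c *\<^sub>R Delta f"
proof -
  have "Poly_Mapping.keys (c *\<^sub>R f) \<subseteq> Poly_Mapping.keys f"
    by (auto simp: in_keys_iff lookup_scaleR)
  then show ?thesis
    by (simp add: Delta_superset[of "Poly_Mapping.keys f"] lookup_scaleR scaleR_sum_right)
qed

lemma Delta_single: "Delta (Poly_Mapping.single I c) = c *\<^sub>R prod_list (map Delta_S (parts I))"
  by (cases "c = 0") (simp_all add: Delta_def)

lemma Delta_mult: "Delta (f * g) = Delta f * Delta g"
proof (induction f rule: poly_mapping_linear_induct)
  case (single I c)
  show ?case
    by (induction g rule: poly_mapping_linear_induct)
      (simp_all add: Delta_single mult_single Delta_add distrib_left)
qed (simp_all add: Delta_add distrib_right)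

lemma Delta_one [simp]: "Delta 1 = 1"
  unfolding single_one[symmetric] Delta_single by simp

lemma Delta_S_eq: "Delta (S_gen n) = (\<Sum>k\<le>n. S_gen k \<otimes> S_gen (n - k))"
proof (cases "n = 0")
  case True
  then show ?thesis by (simp add: S_gen_def)
next
  case False
  then show ?thesis by (simp add: S_gen_def[of n] Delta_single Delta_S_def)
qed

definition primitive :: "ncsf \<Rightarrow> bool"
  where "primitive f \<longleftrightarrow> Delta f = f \<otimes> 1 + 1 \<otimes> f"


text \<open>
  The triangular system \<open>S\<^sup>I = \<Sum>J \<preceq> I. R\<^sub>J\<close> solved for \<open>R\<^sub>I\<close>; see \<open>S_prod_eq_sum_ribbon\<close> and
  \<open>ribbon_unique\<close>.
\<close>

function ribbon :: "composition \<Rightarrow> ncsf"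
  where "ribbon I = S_prod I - (\<Sum>J\<in>{J. J \<preceq> I \<and> J \<noteq> I}. ribbon J)"
  by auto
termination
proof (relation "measure (\<lambda>I. card (Des I))")
  fix I J assume "J \<in> {J. J \<preceq> I \<and> J \<noteq> I}"
  then have "Des J \<subset> Des I" using Des_inj by (auto simp: coarser_def)
  then show "(J, I) \<in> measure (\<lambda>I. card (Des I))" by (simp add: psubset_card_mono)
qed simp

declare ribbon.simps [simp del]

lemma sum_coarser_split:
  "(\<Sum>J\<in>{J. J \<preceq> I}. (R :: composition \<Rightarrow> ncsf) J) = R I + (\<Sum>J\<in>{J. J \<preceq> I \<and> J \<noteq> I}. R J)"
proof -
  have "{J. J \<preceq> I \<and> J \<noteq> I} = {J. J \<preceq> I} - {I}" by auto
  moreover have "I \<preceq> I" by (simp add: coarser_def)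
  ultimately show ?thesis by (simp add: sum.remove)
qed

lemma S_prod_eq_sum_ribbon: "S_prod I = (\<Sum>J\<in>{J. J \<preceq> I}. ribbon J)"
  by (simp add: sum_coarser_split ribbon.simps[of I])

lemma ribbon_unique:
  assumes "\<And>I. S_prod I = (\<Sum>J\<in>{J. J \<preceq> I}. R J)"
  shows "R = ribbon"
proof
  fix I show "R I = ribbon I"
  proof (induction I rule: ribbon.induct)
    case (1 I)
    have "R I = S_prod I - (\<Sum>J\<in>{J. J \<preceq> I \<and> J \<noteq> I}. R J)"
      by (simp add: assms[of I] sum_coarser_split)
    also have "\<dots> = ribbon I"
      using 1 by (simp add: ribbon.simps[of I])
    finally show ?case .
  qed
qed

datatype sign = Plus | Minus

text \<open>Sign sequences are lists, so the sign \<open>\<epsilon>\<^sub>i\<close> is \<open>\<epsilon> ! (i - 1)\<close>.\<close>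

definition sign_composition :: "sign list \<Rightarrow> composition"
  where "sign_composition \<epsilon> = (THE I. weight I = length \<epsilon> + 1 \<and>
    Des I = {i \<in> {1..length \<epsilon>}. \<epsilon> ! (i - 1) = Minus})"

lemma sign_composition:
  "weight (sign_composition \<epsilon>) = length \<epsilon> + 1"
  "Des (sign_composition \<epsilon>) = {i \<in> {1..length \<epsilon>}. \<epsilon> ! (i - 1) = Minus}"
proof -
  have "\<exists>!I. weight I = length \<epsilon> + 1 \<and> Des I = {i \<in> {1..length \<epsilon>}. \<epsilon> ! (i - 1) = Minus}"
    by (rule composition_ex1) auto
  from theI'[OF this]
  show "weight (sign_composition \<epsilon>) = length \<epsilon> + 1"
    "Des (sign_composition \<epsilon>) = {i \<in> {1..length \<epsilon>}. \<epsilon> ! (i - 1) = Minus}"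
    unfolding sign_composition_def by auto
qed

definition ribbon_bullet :: "sign list \<Rightarrow> ncsf"
  where "ribbon_bullet \<epsilon> =
    (let I = sign_composition \<epsilon> in (-1) ^ (length (parts I) - 1) *\<^sub>R ribbon I)"


text \<open>
  The ring \<open>\<real>[a,b]\<close> is \<open>real poly poly\<close>, with \<open>a\<close> the inner and \<open>b\<close> the outer variable.
\<close>

definition var_a :: "real poly poly"
  where "var_a = [:[:0, 1:]:]"

definition var_b :: "real poly poly"
  where "var_b = [:0, 1:]"

text \<open>
  The series \<open>(1 - (a+b)t - \<surd>(1 - 2(a+b)t + (b-a)\<^sup>2t\<^sup>2)) / (2abt)\<close> in the domain \<open>\<real>[a,b][[t]]\<close>:
  \<open>Q\<close> is the square root with constant term 1, and the division by \<open>2abt\<close> is exact.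
\<close>

definition ca_series_spec :: "real poly poly fps \<Rightarrow> bool"
  where "ca_series_spec C \<longleftrightarrow> (\<exists>Q. fps_nth Q 0 = 1 \<and>
     Q ^ 2 = 1 - fps_const (2 * (var_a + var_b)) * fps_X + fps_const ((var_b - var_a) ^ 2) * fps_X ^ 2 \<and>
     fps_const (2 * var_a * var_b) * fps_X * C = 1 - fps_const (var_a + var_b) * fps_X - Q)"

definition ca_series :: "real poly poly fps"
  where "ca_series = (THE C. ca_series_spec C)"

definition ca :: "nat \<Rightarrow> real \<Rightarrow> real \<Rightarrow> real"
  where "ca n a b = poly (poly (fps_nth ca_series n) [:b:]) a"

lemma ca_series_spec_iff:
  "ca_series_spec C \<longleftrightarrow>
    C = fps_X + fps_const (var_a + var_b) * fps_X * C + fps_const (var_a * var_b) * fps_X * C ^ 2"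
proof -
  let ?X = "fps_X :: real poly poly fps"
  define A where "A = fps_const var_a"
  define B where "B = fps_const var_b"
  have c: "fps_const (2 * (var_a + var_b)) = 2 * (A + B)"
    "fps_const ((var_b - var_a) ^ 2) = (B - A) ^ 2"
    "fps_const (2 * var_a * var_b) = 2 * A * B"
    "fps_const (var_a + var_b) = A + B"
    "fps_const (var_a * var_b) = A * B"
    unfolding A_def B_def
    by (simp_all flip: fps_const_add fps_const_sub fps_const_mult fps_const_power
         add: fps_const_power fps_numeral_fps_const distrib_left)
  have nz: "4 * A * B * ?X \<noteq> 0"
    by (simp add: A_def B_def var_a_def var_b_def)
  define Q where "Q = 1 - (A + B) * ?X - 2 * A * B * ?X * C"
  have Q0: "fps_nth Q 0 = 1"
    by (simp add: Q_def mult.assoc)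
  have "(1 - 2 * (A + B) * ?X + (B - A) ^ 2 * ?X ^ 2) - Q ^ 2
      = 4 * A * B * ?X * (C - (?X + (A + B) * ?X * C + A * B * ?X * C ^ 2))"
    unfolding Q_def by (simp add: algebra_simps power2_eq_square)
  then have "Q ^ 2 = 1 - 2 * (A + B) * ?X + (B - A) ^ 2 * ?X ^ 2 \<longleftrightarrow>
      C = ?X + (A + B) * ?X * C + A * B * ?X * C ^ 2"
    using nz by (metis eq_iff_diff_eq_0 mult_eq_0_iff)
  moreover have "ca_series_spec C \<longleftrightarrow> Q ^ 2 = 1 - 2 * (A + B) * ?X + (B - A) ^ 2 * ?X ^ 2"
  proof -
    have "2 * A * B * ?X * C = 1 - (A + B) * ?X - Q' \<longleftrightarrow> Q' = Q" for Q'
      by (auto simp: Q_def algebra_simps)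
    then show ?thesis
      unfolding ca_series_spec_def c using Q0 by auto
  qed
  ultimately show ?thesis unfolding c by simp
qed

lemma ca_series_spec_iff_nth:
  "ca_series_spec C \<longleftrightarrow> (\<forall>n. fps_nth C n = (case n of 0 \<Rightarrow> 0 | Suc m \<Rightarrow>
     (if m = 0 then 1 else 0) + (var_a + var_b) * fps_nth C m
       + var_a * var_b * (\<Sum>i\<le>m. fps_nth C i * fps_nth C (m - i))))"
  unfolding ca_series_spec_iff fps_eq_iff
  by (intro all_cong1)
    (auto split: nat.split
      simp: mult.assoc fps_mult_nth[of C C] power2_eq_square atLeast0AtMost)

fun ca_coeff :: "nat \<Rightarrow> real poly poly"
  where "ca_coeff 0 = 0"
  | "ca_coeff (Suc m) = (if m = 0 then 1 else 0) + (var_a + var_b) * ca_coeff m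
       + var_a * var_b * (\<Sum>i\<le>m. ca_coeff i * ca_coeff (m - i))"

lemma ca_series_spec_iff_coeff: "ca_series_spec C \<longleftrightarrow> C = Abs_fps ca_coeff"
proof
  assume C: "ca_series_spec C"
  have "fps_nth C n = ca_coeff n" for n
  proof (induction n rule: less_induct)
    case (less n)
    have "fps_nth C n = (case n of 0 \<Rightarrow> 0 | Suc m \<Rightarrow>
     (if m = 0 then 1 else 0) + (var_a + var_b) * fps_nth C m
       + var_a * var_b * (\<Sum>i\<le>m. fps_nth C i * fps_nth C (m - i)))"
      using C unfolding ca_series_spec_iff_nth by blast
    also have "\<dots> = ca_coeff n"
      using less by (cases n) auto
    finally show ?case .
  qed
  then show "C = Abs_fps ca_coeff" by (simp add: fps_eq_iff)
next
  assume "C = Abs_fps ca_coeff"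
  then show "ca_series_spec C"
    unfolding ca_series_spec_iff_nth by (auto split: nat.split)
qed

lemma ca_series_eq: "ca_series = Abs_fps ca_coeff"
  unfolding ca_series_def by (rule the_equality) (simp_all add: ca_series_spec_iff_coeff)

lemma ca_0 [simp]: "ca 0 a b = 0"
  by (simp add: ca_def ca_series_eq)

lemma ca_Suc:
  "ca (Suc m) a b = (if m = 0 then 1 else 0) + (a + b) * ca m a b
     + a * b * (\<Sum>i\<le>m. ca i a b * ca (m - i) a b)"
  by (simp add: ca_def ca_series_eq var_a_def var_b_def poly_sum algebra_simps sum_distrib_left)

lemma "ca 1 a b = 1" "ca 2 a b = a + b" "ca 3 a b = a ^ 2 + 3 * a * b + b ^ 2"
  by (simp_all add: ca_Suc numeral_2_eq_2 numeral_3_eq_3 atMost_Suc algebra_simps)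


text \<open>
  The minimal decomposition, as the list of the pairs \<open>(\<eta>\<^sub>i, n\<^sub>i)\<close>; it is characterised by the
  lemmas \<open>concat_stacks\<close>, \<open>stacks_pos\<close>, \<open>distinct_adj_stacks\<close> and \<open>stacks_unique\<close>.
\<close>

fun stacks :: "sign list \<Rightarrow> (sign \<times> nat) list"
  where "stacks [] = []"
  | "stacks (\<eta> # \<epsilon>) = (case stacks \<epsilon> of
        [] \<Rightarrow> [(\<eta>, 1)]
      | (\<eta>', k) # ss \<Rightarrow> if \<eta> = \<eta>' then (\<eta>, Suc k) # ss else (\<eta>, 1) # (\<eta>', k) # ss)"

lemma concat_stacks: "concat (map (\<lambda>(\<eta>, k). replicate k \<eta>) (stacks \<epsilon>)) = \<epsilon>"
  by (induction \<epsilon>) (auto split: list.splits)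

lemma stacks_pos: "(\<eta>, k) \<in> set (stacks \<epsilon>) \<Longrightarrow> k \<ge> 1"
  by (induction \<epsilon> arbitrary: \<eta> k) (fastforce split: list.splits if_splits)+

lemma distinct_adj_stacks: "distinct_adj (map fst (stacks \<epsilon>))"
  by (induction \<epsilon>) (auto split: list.splits simp: distinct_adj_Cons)

lemma stacks_unique:
  assumes "distinct_adj (map fst ss)" "\<And>\<eta> k. (\<eta>, k) \<in> set ss \<Longrightarrow> k \<ge> 1"
  shows "stacks (concat (map (\<lambda>(\<eta>, k). replicate k \<eta>) ss)) = ss"
  using assms
proof (induction ss)
  case (Cons s ss)
  obtain \<eta> k where s: "s = (\<eta>, k)" by (cases s)
  let ?\<epsilon> = "concat (map (\<lambda>(\<eta>, k). replicate k \<eta>) ss)"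
  have IH: "stacks ?\<epsilon> = ss"
    using Cons by (auto dest: distinct_adj_ConsD)
  have hd: "ss = [] \<or> \<eta> \<noteq> fst (hd ss)"
    using Cons.prems(1) s by (auto simp: distinct_adj_Cons hd_map)
  have "stacks (replicate (Suc j) \<eta> @ ?\<epsilon>) = (\<eta>, Suc j) # ss" for j
    using hd by (induction j) (auto simp: IH split: list.splits)
  moreover obtain j where "k = Suc j"
    using Cons.prems(2)[of \<eta> k] s by (cases k) auto
  ultimately show ?case using s by simp
qed simp

definition D_coeff :: "real \<Rightarrow> real \<Rightarrow> sign list \<Rightarrow> real"
  where "D_coeff a b \<epsilon> = (let ss = stacks \<epsilon>; s = length ss in
     (\<Prod>i\<in>{i. Suc i < s \<and> fst (ss ! i) = Plus}. a)
   * (\<Prod>i\<in>{i. Suc i < s \<and> fst (ss ! i) = Minus}. b)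
   * (\<Prod>i<s. ca (snd (ss ! i)) a b))"

text \<open>The index \<open>n\<close> is the number of signs: \<open>D_elem a b n\<close> is the element \<open>D\<^sub>a\<^sub>,\<^sub>b\<^sup>n\<^sup>+\<^sup>1\<close> of degree \<open>n + 1\<close>.\<close>

definition D_elem :: "real \<Rightarrow> real \<Rightarrow> nat \<Rightarrow> ncsf"
  where "D_elem a b n = (\<Sum>\<epsilon>\<in>{\<epsilon>. length \<epsilon> = n}. D_coeff a b \<epsilon> *\<^sub>R ribbon_bullet \<epsilon>)"

lemma finite_sign_lists: "finite {\<epsilon> :: sign list. length \<epsilon> = n}"
proof -
  have "(UNIV :: sign set) = {Plus, Minus}"
    using sign.exhaust by auto
  then have "finite (UNIV :: sign set)" by (metis finite.emptyI finite.insertI)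
  from finite_lists_length_eq[OF this, of n] show ?thesis by simp
qed

end

theory Submission
  imports Defs "HOL-Computational_Algebra.Formal_Laurent_Series"
begin

text \<open>
  An element \<open>\<Sum>\<^sub>I \<mu>(I) S\<^sup>I\<close> without constant term is primitive iff the coefficient form \<open>\<mu>\<close> vanishes on quasi-shuffles
  of nonempty compositions: the quasi-shuffle is the product of monomial quasi-symmetric functions,
  dual to the coproduct (\<open>lookup_Delta_S_prod\<close>).  Such forms come from Rota-Baxter operators.  If
  \<open>P\<close> is the projection of a commutative ring onto one of two complementary subrings and \<open>Q = - P\<close>, then
  \<open>I \<mapsto> Q(f\<^sup>i\<^sup>r \<cdots> Q(f\<^sup>i\<^sup>2 Q(f\<^sup>i\<^sup>1)))\<close> turns quasi-shuffles into products (\<open>nest_quasi_shuffle\<close>), so that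
  composing it with an additive form that vanishes on products of two elements of the range of \<open>P\<close>
  gives a primitive element.

  In terms of ribbons, summing over all compositions finer than a given one replaces \<open>id\<close> by
  \<open>id + Q = id - P\<close> wherever there is a plus sign.  Hence the coefficient of \<open>R\<^sub>\<epsilon>\<^sub>\<bullet>\<close> is, for all
  \<open>\<epsilon>\<close> up to one common sign, the value of the form at the end of a walk: start at \<open>f\<close>, and for each sign project to one of the two subrings (\<open>P\<close> for
  minus, \<open>id - P\<close> for plus), then multiply by \<open>f\<close> (\<open>primitive_sum_walk\<close>).  This is the algebraic form
  of recording the signs of the partial sums of a random walk.

  Here the ring is that of Laurent series in \<open>y\<close>, \<open>P\<close> takes the polar part, the form is the residue,
  and \<open>f = a w + b v\<close> with \<open>w = 1/(1 - y)\<close> and \<open>v = 1/y\<close>.  From \<open>w v = w + v\<close> it follows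
  that a walk which leaves the side of \<open>w\<close> arrives at a multiple of \<open>v\<close> itself, from
  whichever power of \<open>w\<close> it comes, and conversely.  This lack of memory, as for a geometrically
  distributed overshoot, makes the residue a product over the stacks.  One stack contributes
  \<open>ca\<close>: with \<open>C = \<Sum> ca\<^sub>n t\<^sup>n\<close> one has \<open>C = t (1 + a C) (1 + b C)\<close>, and the steps
  within a plus stack that starts at \<open>w\<^sup>k\<close> are counted by \<open>(1 + a C) (1 + b C)\<^sup>k\<close>
  (\<open>linear_kernel_stay\<close>).  The resulting primitive element is \<open>a b D\<^sub>a\<^sub>,\<^sub>b\<close> (\<open>residue_walk\<close>).  The case
  \<open>a b = 0\<close> follows because the coefficients of \<open>D\<^sub>a\<^sub>,\<^sub>b\<close> are continuous in \<open>a\<close> and \<open>b\<close>.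
\<close>

section \<open>The coproduct and the quasi-shuffle\<close>

lemma lookup_times_single_inj:
  fixes X :: "'a :: monoid_add \<Rightarrow>\<^sub>0 'b :: semiring_1"
  assumes "\<And>r r'. r + p = r' + p \<Longrightarrow> r = r'"
  shows "Poly_Mapping.lookup (X * Poly_Mapping.single p 1) (r + p) = Poly_Mapping.lookup X r"
  by (induction X rule: poly_mapping_linear_induct)
    (auto simp: mult_single lookup_single when_def distrib_right lookup_add dest: assms)

lemma lookup_times_single_notin:
  fixes X :: "'a :: monoid_add \<Rightarrow>\<^sub>0 'b :: semiring_1"
  assumes "\<And>r. r + p \<noteq> q"
  shows "Poly_Mapping.lookup (X * Poly_Mapping.single p 1) q = 0"
  by (induction X rule: poly_mapping_linear_induct)
    (use assms in \<open>auto simp: mult_single lookup_single when_def distrib_right lookup_add\<close>)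

text \<open>A list of terms, because multiplicities count.\<close>
fun quasi_shuffle :: "nat list \<Rightarrow> nat list \<Rightarrow> nat list list"
  where "quasi_shuffle [] K = [K]"
  | "quasi_shuffle (i # I) [] = [i # I]"
  | "quasi_shuffle (i # I) (k # K) =
      map ((#) i) (quasi_shuffle I (k # K)) @ map ((#) k) (quasi_shuffle (i # I) K) @
      map ((#) (i + k)) (quasi_shuffle I K)"

lemma quasi_shuffle_Nil_right [simp]: "quasi_shuffle I [] = [I]"
  by (cases I) auto

lemma quasi_shuffle_sum_pos:
  "J \<in> set (quasi_shuffle I K) \<Longrightarrow>
    sum_list J = sum_list I + sum_list K \<and> (0 \<notin> set I \<longrightarrow> 0 \<notin> set K \<longrightarrow> 0 \<notin> set J)"
  by (induction I K arbitrary: J rule: quasi_shuffle.induct) auto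

lemma count_list_map_Cons:
  "count_list (map ((#) x) xs) ys = (case ys of [] \<Rightarrow> 0 | y # ys' \<Rightarrow> if x = y then count_list xs ys' else 0)"
  by (induction xs) (auto split: list.splits)

text \<open>The convention \<open>S\<^sub>0 = 1\<close> makes the part \<open>0\<close> stand for the empty composition.\<close>
definition comp_of_part :: "nat \<Rightarrow> composition"
  where "comp_of_part k = (if k = 0 then 0 else composition_of [k])"

lemma parts_comp_of_part: "parts (comp_of_part k) = (if k = 0 then [] else [k])"
  by (simp add: comp_of_part_def)

lemma Delta_S_single:
  "Delta_S n = (\<Sum>k\<le>n. Poly_Mapping.single (comp_of_part k, comp_of_part (n - k)) 1)"
proof -
  have "S_gen k = Poly_Mapping.single (comp_of_part k) 1" for k
    by (simp add: S_gen_def comp_of_part_def)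
  then show ?thesis
    by (simp add: Delta_S_def tensor_single)
qed

text \<open>
  The lists are reversed throughout: the recursion peels off the last factor of a product, which is
  therefore the head of the list.  The last factor is the outermost one in the nested
  products below, and the signs of a sequence are then applied from \<open>\<epsilon>\<^sub>1\<close> onwards.
\<close>
lemma lookup_times_single_part:
  fixes X :: ncsf2
  assumes I: "0 \<notin> set I" and K: "0 \<notin> set K"
  shows "Poly_Mapping.lookup (X * Poly_Mapping.single (comp_of_part k, comp_of_part l) 1)
      (composition_of (rev I), composition_of (rev K)) =
    (if (k = 0 \<or> I \<noteq> [] \<and> hd I = k) \<and> (l = 0 \<or> K \<noteq> [] \<and> hd K = l)
     then Poly_Mapping.lookup X (composition_of (rev (if k = 0 then I else tl I)),
                                 composition_of (rev (if l = 0 then K else tl K)))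
     else 0)" (is "?lhs = _")
proof (cases "(k = 0 \<or> I \<noteq> [] \<and> hd I = k) \<and> (l = 0 \<or> K \<noteq> [] \<and> hd K = l)")
  case True
  have split: "composition_of (rev L) = composition_of (rev (if m = 0 then L else tl L)) + comp_of_part m"
    if "0 \<notin> set L" "m = 0 \<or> L \<noteq> [] \<and> hd L = m" for L m
    using that by (cases L) (auto simp: parts_comp_of_part simp flip: parts_inject)
  have "?lhs = Poly_Mapping.lookup (X * Poly_Mapping.single (comp_of_part k, comp_of_part l) 1)
      ((composition_of (rev (if k = 0 then I else tl I)), composition_of (rev (if l = 0 then K else tl K)))
        + (comp_of_part k, comp_of_part l))"
    using split[OF I, of k] split[OF K, of l] True by simp
  also have "\<dots> = Poly_Mapping.lookup X (composition_of (rev (if k = 0 then I else tl I)),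
                                 composition_of (rev (if l = 0 then K else tl K)))"
    by (rule lookup_times_single_inj) (auto simp flip: parts_inject)
  finally show ?thesis using True by simp
next
  case False
  have no: "r + comp_of_part m \<noteq> composition_of (rev L)"
    if "0 \<notin> set L" "\<not> (m = 0 \<or> L \<noteq> [] \<and> hd L = m)" for L m r
    using that by (cases L) (auto simp: parts_comp_of_part simp flip: parts_inject)
  have "?lhs = 0"
    by (rule lookup_times_single_notin) (use False no[OF I] no[OF K] in auto)
  then show ?thesis unfolding if_not_P[OF False] .
qed

text \<open>
  In \<open>\<Delta> S\<^sub>j = \<Sum> S\<^sub>k \<otimes> S\<^sub>j\<^sub>-\<^sub>k\<close> the term \<open>k = 0\<close> appends \<open>j\<close> on the right tensor factor, the term \<open>k = j\<close> on the
  left one, and the other terms split \<open>j\<close> between both.  These are the three summands of the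
  quasi-shuffle recursion.
\<close>
lemma lookup_Delta_S_prod:
  assumes "0 \<notin> set I" "0 \<notin> set K" "0 \<notin> set J"
  shows "Poly_Mapping.lookup (prod_list (map Delta_S (rev J)))
      (composition_of (rev I), composition_of (rev K)) = real (count_list (quasi_shuffle I K) J)"
  using assms
proof (induction J arbitrary: I K)
  case Nil
  have "composition_of L = 0 \<longleftrightarrow> L = []" if "0 \<notin> set L" for L
    using that by (auto simp flip: parts_inject)
  moreover have "count_list (quasi_shuffle I K) [] = (if I = [] \<and> K = [] then 1 else 0)"
    by (cases "(I, K)" rule: quasi_shuffle.cases) (auto simp: count_list_map_Cons)
  ultimately show ?case
    using Nil by (auto simp: lookup_one when_def zero_prod_def)
next
  case (Cons j J)
  let ?X = "prod_list (map Delta_S (rev J))"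
  let ?c = "\<lambda>L. composition_of (rev L)"
  let ?t = "\<lambda>k. Poly_Mapping.lookup (?X * Poly_Mapping.single (comp_of_part k, comp_of_part (j - k)) 1) (?c I, ?c K)"
  have j: "j > 0" using Cons.prems by auto
  have J: "0 \<notin> set J" and tl: "0 \<notin> set (tl I)" "0 \<notin> set (tl K)"
    using Cons.prems by (cases I; cases K; auto)+
  have "Poly_Mapping.lookup (prod_list (map Delta_S (rev (j # J)))) (?c I, ?c K) = (\<Sum>k\<le>j. ?t k)"
    by (simp add: Delta_S_single sum_distrib_left lookup_sum)
  also have "{..j} = insert 0 (insert j {1..<j})"
    using j by auto
  also have "(\<Sum>k\<in>\<dots>. ?t k) = ?t 0 + ?t j + (\<Sum>k\<in>{1..<j}. ?t k)"
    using j by simp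
  also have "?t 0 = (if K \<noteq> [] \<and> hd K = j then real (count_list (quasi_shuffle I (tl K)) J) else 0)"
    using Cons.prems j by (subst lookup_times_single_part) (auto simp: Cons.IH J tl)
  also have "?t j = (if I \<noteq> [] \<and> hd I = j then real (count_list (quasi_shuffle (tl I) K) J) else 0)"
    using Cons.prems j by (subst lookup_times_single_part) (auto simp: Cons.IH J tl)
  also have "(\<Sum>k\<in>{1..<j}. ?t k) =
      (\<Sum>k\<in>{1..<j}. if k = hd I then if I \<noteq> [] \<and> K \<noteq> [] \<and> hd K = j - k
         then real (count_list (quasi_shuffle (tl I) (tl K)) J) else 0 else 0)"
    using Cons.prems by (intro sum.cong refl, subst lookup_times_single_part)
      (auto simp: Cons.IH J tl)
  also have "\<dots> = (if I \<noteq> [] \<and> K \<noteq> [] \<and> hd I + hd K = j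
      then real (count_list (quasi_shuffle (tl I) (tl K)) J) else 0)"
  proof -
    have "hd L > 0" if "L \<noteq> []" "0 \<notin> set L" for L :: "nat list"
      using that by (cases L) auto
    then have pos: "I \<noteq> [] \<Longrightarrow> hd I > 0" "K \<noteq> [] \<Longrightarrow> hd K > 0"
      using Cons.prems by blast+
    show ?thesis
    proof (cases "I \<noteq> [] \<and> K \<noteq> [] \<and> hd I + hd K = j")
      case True
      then have "hd I \<in> {1..<j}" "hd K = j - hd I"
        using pos by force+
      then show ?thesis using True by simp
    next
      case False
      then have "(if I \<noteq> [] \<and> K \<noteq> [] \<and> hd K = j - k then c else 0) = 0"
        if "k \<in> {1..<j}" "k = hd I" for k and c :: real
        using that by auto
      then show ?thesis
        unfolding if_not_P[OF False] by (intro sum.neutral) auto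
    qed
  qed
  finally show ?case
    by (cases "(I, K)" rule: quasi_shuffle.cases) (auto simp: count_list_map_Cons)
qed

lemma sum_list_map_eq_sum_count_real:
  fixes g :: "'b \<Rightarrow> real"
  assumes "finite A" "set xs \<subseteq> A"
  shows "sum_list (map g xs) = (\<Sum>y\<in>A. g y * real (count_list xs y))"
  using assms(2)
proof (induction xs)
  case (Cons x xs)
  have "(\<Sum>y\<in>A. g y * real (count_list (x # xs) y))
      = (\<Sum>y\<in>A. (if y = x then g x else 0) + g y * real (count_list xs y))"
    by (intro sum.cong) (auto simp: distrib_left)
  with Cons assms(1) show ?case by (simp add: sum.distrib)
qed simp

section \<open>Primitive elements from Rota-Baxter operators\<close>

text \<open>
  Weight \<open>-1\<close>: the axiom holds for the projection onto a subring along a complementary subring, and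
  its negative satisfies \<open>Q x * Q y = Q (x * Q y) + Q (Q x * y) + Q (x * y)\<close>, which has the shape
  of the quasi-shuffle recursion.
\<close>
locale rota_baxter =
  fixes P :: "'a :: comm_ring_1 \<Rightarrow> 'a"
  assumes add: "P (x + y) = P x + P y"
    and rota_baxter: "P x * P y = P (x * P y) + P (P x * y) - P (x * y)"
begin

lemma zero [simp]: "P 0 = 0"
  using add[of 0 0] by simp

lemma minus: "P (- x) = - P x"
  using add[of x "- x"] by (simp add: minus_unique)

definition nest :: "'a \<Rightarrow> nat list \<Rightarrow> 'a"
  where "nest f J = foldr (\<lambda>j u. - P (f ^ j * u)) J 1"

lemma nest_simps [simp]: "nest f [] = 1" "nest f (j # J) = - P (f ^ j * nest f J)"
  by (simp_all add: nest_def)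

lemma sum_list_nest_Cons:
  "sum_list (map (\<lambda>J. nest f (j # J)) Js) = - P (f ^ j * sum_list (map (nest f) Js))"
  by (induction Js) (simp_all add: add distrib_left)

text \<open>
  With \<open>Q = - P\<close>, \<open>x = f\<^sup>i nest I\<close> and \<open>y = f\<^sup>k nest K\<close>, the three terms of the Rota-Baxter identity for \<open>Q x * Q y\<close>
  are the three terms of the quasi-shuffle of \<open>i # I\<close> and \<open>k # K\<close>.
\<close>
lemma nest_quasi_shuffle:
  "sum_list (map (nest f) (quasi_shuffle I K)) = nest f I * nest f K"
proof (induction I K rule: quasi_shuffle.induct)
  case (3 i I k K)
  let ?x = "f ^ i * nest f I" and ?y = "f ^ k * nest f K"
  have "sum_list (map (nest f) (quasi_shuffle (i # I) (k # K)))
      = sum_list (map (\<lambda>J. nest f (i # J)) (quasi_shuffle I (k # K)))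
        + sum_list (map (\<lambda>J. nest f (k # J)) (quasi_shuffle (i # I) K))
        + sum_list (map (\<lambda>J. nest f ((i + k) # J)) (quasi_shuffle I K))"
    by (simp add: o_def)
  also have "\<dots> = - P (f ^ i * (nest f I * nest f (k # K))) - P (f ^ k * (nest f (i # I) * nest f K))
        - P (f ^ (i + k) * (nest f I * nest f K))"
    unfolding sum_list_nest_Cons 3 by simp
  also have "\<dots> = P (?x * P ?y) + P (P ?x * ?y) - P (?x * ?y)"
    by (simp add: minus power_add mult_ac)
  also have "\<dots> = nest f (i # I) * nest f (k # K)"
    by (simp add: rota_baxter)
  finally show ?case .
qed simp_all

text \<open>
  By \<open>lookup_Delta_S_prod\<close> and \<open>nest_quasi_shuffle\<close>, the coefficient of \<open>S\<^sup>I \<otimes> S\<^sup>K\<close> in the coproduct of this element is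
  \<open>res\<close> of the product of the nested terms of \<open>I\<close> and \<open>K\<close>.  For nonempty \<open>I\<close> and \<open>K\<close> both factors lie in the
  range of \<open>P\<close>.
\<close>
lemma primitive_nest:
  fixes res :: "'a \<Rightarrow> real"
  assumes add_res: "\<And>x y. res (x + y) = res x + res y"
    and res_mult: "\<And>x y. res (P x * P y) = 0"
    and n: "n > 0"
  shows "primitive (\<Sum>J | weight J = n. res (nest f (rev (parts J))) *\<^sub>R S_prod J)" (is "primitive ?D")
  unfolding primitive_def
proof (rule poly_mapping_eqI)
  fix q :: "composition \<times> composition"
  obtain I K where q: "q = (I, K)" by (cases q)
  define g where "g L = res (nest f L)" for L
  let ?A = "{J. weight J = n}" and ?r = "\<lambda>J. rev (parts J)"
  have res0: "res 0 = 0" using add_res[of 0 0] by simp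
  have sum_g: "res (sum_list (map (nest f) Ls)) = sum_list (map g Ls)" for Ls
    by (induction Ls) (simp_all add: res0 add_res g_def)
  have lookup_D: "Poly_Mapping.lookup ?D J = (if weight J = n then g (?r J) else 0)" for J
    by (simp add: lookup_sum lookup_scaleR S_prod_eq_single lookup_single when_def g_def finite_weight
        if_distrib[of "(*) _"] cong: if_cong)
  have Delta_sum: "Delta (\<Sum>J\<in>B. h J) = (\<Sum>J\<in>B. Delta (h J))" if "finite B" for B and h :: "composition \<Rightarrow> ncsf"
    using that by induction (simp_all add: Delta_add)
  have "Poly_Mapping.lookup (Delta ?D) (I, K)
      = (\<Sum>J\<in>?A. g (?r J) * Poly_Mapping.lookup (prod_list (map Delta_S (parts J))) (I, K))"
    by (simp add: Delta_sum finite_weight Delta_scaleR S_prod_eq_single Delta_single lookup_sum lookup_scaleR g_def)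
  also have "\<dots> = (\<Sum>J\<in>?A. g (?r J) * real (count_list (quasi_shuffle (?r I) (?r K)) (?r J)))"
  proof (rule sum.cong)
    fix J
    show "g (?r J) * Poly_Mapping.lookup (prod_list (map Delta_S (parts J))) (I, K)
        = g (?r J) * real (count_list (quasi_shuffle (?r I) (?r K)) (?r J))"
      using lookup_Delta_S_prod[of "?r I" "?r K" "?r J"] by (simp add: parts_pos parts_inverse)
  qed simp
  also have "\<dots> = (\<Sum>L\<in>?r ` ?A. g L * real (count_list (quasi_shuffle (?r I) (?r K)) L))"
    by (subst sum.reindex) (auto simp: inj_on_def parts_inject)
  also have "\<dots> = (if weight I + weight K = n then g_sum else 0)"
    if "g_sum = sum_list (map g (quasi_shuffle (?r I) (?r K)))" for g_sum
  proof (cases "weight I + weight K = n")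
    case True
    have "set (quasi_shuffle (?r I) (?r K)) \<subseteq> ?r ` ?A"
    proof
      fix L assume "L \<in> set (quasi_shuffle (?r I) (?r K))"
      from quasi_shuffle_sum_pos[OF this] have "sum_list L = n" "0 \<notin> set L"
        using True by (auto simp: weight_def parts_pos)
      then show "L \<in> ?r ` ?A"
        by (intro image_eqI[of _ _ "composition_of (rev L)"]) (simp_all add: weight_def)
    qed
    with True show ?thesis unfolding that
      by (subst sum_list_map_eq_sum_count_real[of "?r ` ?A"]) (auto simp: finite_weight)
  next
    case False
    have "g L * real (count_list (quasi_shuffle (?r I) (?r K)) L) = 0" if L: "L \<in> ?r ` ?A" for L
    proof -
      have "L \<notin> set (quasi_shuffle (?r I) (?r K))"
        using L False quasi_shuffle_sum_pos[of L "?r I" "?r K"] by (auto simp: weight_def)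
      then show ?thesis by (simp add: count_list_0_iff)
    qed
    then show ?thesis unfolding if_not_P[OF False] by (intro sum.neutral ballI)
  qed
  finally have "Poly_Mapping.lookup (Delta ?D) (I, K)
      = (if weight I + weight K = n then res (nest f (?r I) * nest f (?r K)) else 0)"
    by (simp add: sum_g[symmetric] nest_quasi_shuffle)
  also have "\<dots> = Poly_Mapping.lookup (?D \<otimes> 1 + 1 \<otimes> ?D) (I, K)"
  proof (cases "I = 0 \<or> K = 0")
    case True
    moreover have "weight 0 = 0" by (simp add: weight_def)
    ultimately show ?thesis using n
      by (auto simp: lookup_add lookup_tensor lookup_D lookup_one when_def g_def)
  next
    case False
    then have "?r I \<noteq> []" "?r K \<noteq> []"
      by (auto simp flip: parts_inject)
    then obtain i I' k K' where "?r I = i # I'" "?r K = k # K'"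
      by (meson neq_Nil_conv)
    then have "res (nest f (?r I) * nest f (?r K)) = 0"
      by (simp add: res_mult)
    then show ?thesis using False
      by (simp add: lookup_add lookup_tensor lookup_one when_def)
  qed
  finally show "Poly_Mapping.lookup (Delta ?D) q = Poly_Mapping.lookup (?D \<otimes> 1 + 1 \<otimes> ?D) q"
    by (simp add: q)
qed

end

section \<open>Sign sequences and ribbons\<close>

text \<open>
  The parts of the composition of a sign sequence by recursion on its first sign: a plus joins the
  first cell to the part that follows, a minus cuts it off.
\<close>
fun sign_parts :: "sign list \<Rightarrow> nat list"
  where "sign_parts [] = [1]"
  | "sign_parts (Plus # \<epsilon>) = Suc (hd (sign_parts \<epsilon>)) # tl (sign_parts \<epsilon>)"
  | "sign_parts (Minus # \<epsilon>) = 1 # sign_parts \<epsilon>"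

lemma sign_parts_Cons: obtains j js where "sign_parts \<epsilon> = j # js"
  by (cases \<epsilon> rule: sign_parts.cases) auto

lemma sign_parts_props:
  "0 \<notin> set (sign_parts \<epsilon>)" "sum_list (sign_parts \<epsilon>) = length \<epsilon> + 1"
  "length (sign_parts \<epsilon>) = count_list \<epsilon> Minus + 1"
proof -
  have "0 \<notin> set (sign_parts \<epsilon>) \<and> sum_list (sign_parts \<epsilon>) = length \<epsilon> + 1 \<and>
      length (sign_parts \<epsilon>) = count_list \<epsilon> Minus + 1"
  proof (induction \<epsilon> rule: sign_parts.induct)
    case (2 \<epsilon>)
    then show ?case by (cases rule: sign_parts_Cons[of \<epsilon>]) auto
  qed auto
  then show "0 \<notin> set (sign_parts \<epsilon>)" "sum_list (sign_parts \<epsilon>) = length \<epsilon> + 1"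
    "length (sign_parts \<epsilon>) = count_list \<epsilon> Minus + 1" by auto
qed

lemma minus_positions_Cons:
  "{i \<in> {1..length (\<eta> # \<epsilon>)}. (\<eta> # \<epsilon>) ! (i - 1) = Minus} =
    (if \<eta> = Minus then {1} else {}) \<union> Suc ` {i \<in> {1..length \<epsilon>}. \<epsilon> ! (i - 1) = Minus}" (is "?l = ?r")
proof (rule set_eqI)
  fix i
  show "i \<in> ?l \<longleftrightarrow> i \<in> ?r"
  proof (cases i)
    case (Suc k)
    show ?thesis unfolding Suc by (cases k) auto
  qed auto
qed

lemma sum_take_sign_parts:
  "(\<lambda>k. sum_list (take k (sign_parts \<epsilon>))) ` {1..<length (sign_parts \<epsilon>)} =
    {i \<in> {1..length \<epsilon>}. \<epsilon> ! (i - 1) = Minus}"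
proof (induction \<epsilon> rule: sign_parts.induct)
  case (2 \<epsilon>)
  obtain j js where js: "sign_parts \<epsilon> = j # js" by (rule sign_parts_Cons)
  have "sum_list (take k (Suc j # js)) = Suc (sum_list (take k (j # js)))" if "k \<ge> 1" for k
    using that by (cases k) auto
  then have "(\<lambda>k. sum_list (take k (Suc j # js))) ` {1..<length (Suc j # js)}
      = Suc ` (\<lambda>k. sum_list (take k (j # js))) ` {1..<length (j # js)}"
    unfolding image_image by (intro image_cong) auto
  then show ?case
    using 2 unfolding minus_positions_Cons js sign_parts.simps(2) by (simp add: js)
next
  case (3 \<epsilon>)
  obtain j js where js: "sign_parts \<epsilon> = j # js" by (rule sign_parts_Cons)
  show ?case
    using 3 unfolding minus_positions_Cons sign_parts.simps(3) js image_take_Cons_Cons by simp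
qed simp

lemma parts_sign_composition: "parts (sign_composition \<epsilon>) = sign_parts \<epsilon>"
proof -
  have "sign_composition \<epsilon> = composition_of (sign_parts \<epsilon>)"
  proof (rule Des_inj)
    show "Des (sign_composition \<epsilon>) = Des (composition_of (sign_parts \<epsilon>))"
      unfolding sign_composition Des_def[of "composition_of _"]
      by (simp only: parts_composition_of[OF sign_parts_props(1)] sum_take_sign_parts)
  qed (simp add: sign_composition, simp add: weight_def sign_parts_props)
  then show ?thesis by (simp add: sign_parts_props)
qed

lemma ribbon_bullet_eq:
  "ribbon_bullet \<epsilon> = (-1) ^ count_list \<epsilon> Minus *\<^sub>R ribbon (sign_composition \<epsilon>)"
  by (simp add: ribbon_bullet_def parts_sign_composition sign_parts_props)

text \<open>The order of inclusion of the positions of the minus signs.\<close>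
definition sign_le :: "sign list \<Rightarrow> sign list \<Rightarrow> bool"
  where "sign_le = list_all2 (\<lambda>\<eta> \<eta>'. \<eta> = Minus \<longrightarrow> \<eta>' = Minus)"

lemma sign_composition_coarser_iff:
  "sign_composition \<epsilon> \<preceq> sign_composition \<epsilon>' \<longleftrightarrow> sign_le \<epsilon> \<epsilon>'"
proof -
  have "{i \<in> {1..n}. \<epsilon> ! (i - 1) = Minus} \<subseteq> {i \<in> {1..n}. \<epsilon>' ! (i - 1) = Minus} \<longleftrightarrow>
      (\<forall>i<n. \<epsilon> ! i = Minus \<longrightarrow> \<epsilon>' ! i = Minus)" (is "?A \<subseteq> ?B \<longleftrightarrow> ?R") for n
  proof
    assume "?A \<subseteq> ?B"
    then have "Suc i \<in> ?A \<Longrightarrow> Suc i \<in> ?B" for i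
      by (rule subsetD)
    then show ?R by simp
  next
    assume R: ?R
    show "?A \<subseteq> ?B"
    proof
      fix i assume "i \<in> ?A"
      moreover from this have "i - 1 < n" by auto
      ultimately show "i \<in> ?B" using R by blast
    qed
  qed
  then show ?thesis
    unfolding coarser_def sign_composition sign_le_def list_all2_conv_all_nth by auto
qed

lemma inj_sign_composition: "inj sign_composition"
proof (rule injI)
  fix \<epsilon> \<epsilon>' assume eq: "sign_composition \<epsilon> = sign_composition \<epsilon>'"
  have "I \<preceq> I" for I by (simp add: coarser_def)
  then have "sign_le \<epsilon> \<epsilon>'" "sign_le \<epsilon>' \<epsilon>"
    using eq by (simp_all flip: sign_composition_coarser_iff)
  then have "length \<epsilon> = length \<epsilon>'" "\<forall>i<length \<epsilon>. \<epsilon> ! i = Minus \<longleftrightarrow> \<epsilon>' ! i = Minus"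
    by (auto simp: sign_le_def list_all2_conv_all_nth)
  then show "\<epsilon> = \<epsilon>'"
  proof (intro nth_equalityI)
    fix i assume "i < length \<epsilon>"
    then have "\<epsilon> ! i = Minus \<longleftrightarrow> \<epsilon>' ! i = Minus"
      using \<open>\<forall>i<length \<epsilon>. _\<close> by blast
    then show "\<epsilon> ! i = \<epsilon>' ! i"
      by (cases "\<epsilon> ! i"; cases "\<epsilon>' ! i") simp_all
  qed
qed

lemma Des_subset: "Des I \<subseteq> {1..<weight I}"
proof
  fix x assume "x \<in> Des I"
  then obtain k where k: "k \<in> {1..<length (parts I)}" "x = sum_list (take k (parts I))"
    by (auto simp: Des_def)
  have pos: "sum_list xs > 0" if "xs \<noteq> []" "set xs \<subseteq> set (parts I)" for xs
    using that parts_pos[of I] by (cases xs) (auto intro!: gr0I)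
  have "sum_list (take k (parts I)) > 0" "sum_list (drop k (parts I)) > 0"
    using k by (intro pos; auto dest: in_set_takeD in_set_dropD)+
  moreover have "weight I = sum_list (take k (parts I)) + sum_list (drop k (parts I))"
    unfolding weight_def by (metis append_take_drop_id sum_list_append)
  ultimately show "x \<in> {1..<weight I}" using k by simp
qed

lemma range_sign_composition:
  assumes "weight I = n + 1"
  shows "\<exists>\<epsilon>. length \<epsilon> = n \<and> I = sign_composition \<epsilon>"
proof -
  define \<epsilon> where "\<epsilon> = map (\<lambda>i. if Suc i \<in> Des I then Minus else Plus) [0..<n]"
  have "Des I \<subseteq> {1..n}" using Des_subset[of I] assms by auto
  then have "Des I = Des (sign_composition \<epsilon>)"
    unfolding sign_composition by (auto simp: \<epsilon>_def split: if_splits) force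
  then have "I = sign_composition \<epsilon>"
    using assms by (intro Des_inj) (simp_all add: sign_composition \<epsilon>_def)
  then show ?thesis by (intro exI[of _ \<epsilon>]) (simp add: \<epsilon>_def)
qed

lemma bij_betw_sign_composition:
  "bij_betw sign_composition {\<epsilon>. length \<epsilon> = n} {I. weight I = n + 1}"
proof (rule bij_betw_imageI)
  show "inj_on sign_composition {\<epsilon>. length \<epsilon> = n}"
    by (rule inj_on_subset[OF inj_sign_composition]) simp
  show "sign_composition ` {\<epsilon>. length \<epsilon> = n} = {I. weight I = n + 1}"
    using range_sign_composition[of _ n] by (fastforce simp: sign_composition)
qed

lemma S_prod_sign_composition:
  "S_prod (sign_composition \<epsilon>) = (\<Sum>\<epsilon>' | sign_le \<epsilon>' \<epsilon>. ribbon (sign_composition \<epsilon>'))"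
proof -
  have "{J. J \<preceq> sign_composition \<epsilon>} = sign_composition ` {\<epsilon>'. sign_le \<epsilon>' \<epsilon>}"
  proof (intro equalityI subsetI)
    fix J assume J: "J \<in> {J. J \<preceq> sign_composition \<epsilon>}"
    then have "weight J = length \<epsilon> + 1" by (simp add: coarser_def sign_composition)
    with J show "J \<in> sign_composition ` {\<epsilon>'. sign_le \<epsilon>' \<epsilon>}"
      using range_sign_composition[of J] by (auto simp: sign_composition_coarser_iff)
  qed (auto simp: sign_composition_coarser_iff)
  then show ?thesis
    unfolding S_prod_eq_sum_ribbon
    by (simp add: sum.reindex inj_on_subset[OF inj_sign_composition])
qed

section \<open>Walks\<close>

text \<open>
  The rule \<open>h\<close> is applied before each multiplication by \<open>f\<close>, so the value after the last
  multiplication is left as it is: this matches the undetermined last sign in \<open>\<epsilon>\<bullet>\<close>.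
\<close>
definition walk :: "('a \<Rightarrow> sign \<Rightarrow> 'a) \<Rightarrow> 'a :: semiring_1 \<Rightarrow> 'a \<Rightarrow> sign list \<Rightarrow> 'a"
  where "walk h f = foldl (\<lambda>u \<eta>. f * h u \<eta>)"

lemma walk_simps [simp]:
  "walk h f u [] = u" "walk h f u (\<eta> # \<epsilon>) = walk h f (f * h u \<eta>) \<epsilon>"
  by (simp_all add: walk_def)

lemma walk_append: "walk h f u (\<epsilon> @ \<epsilon>') = walk h f (walk h f u \<epsilon>) \<epsilon>'"
  by (simp add: walk_def)

context rota_baxter
begin

text \<open>
  \<open>cut_step\<close> describes the coefficients in the basis \<open>S\<^sup>I\<close>, where a plus sign is no condition at all;
  \<open>proj_step\<close> describes those in the ribbon basis.
\<close>
definition cut_step :: "'a \<Rightarrow> sign \<Rightarrow> 'a"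
  where "cut_step u \<eta> = (case \<eta> of Plus \<Rightarrow> u | Minus \<Rightarrow> - P u)"

definition proj_step :: "'a \<Rightarrow> sign \<Rightarrow> 'a"
  where "proj_step u \<eta> = (case \<eta> of Plus \<Rightarrow> u - P u | Minus \<Rightarrow> P u)"

lemma step_simps [simp]:
  "cut_step u Plus = u" "cut_step u Minus = - P u" "proj_step u Plus = u - P u" "proj_step u Minus = P u"
  by (simp_all add: cut_step_def proj_step_def)

lemma nest_sign_parts: "nest f (rev (sign_parts \<epsilon>)) = - P (walk cut_step f f \<epsilon>)"
proof -
  have "foldl (\<lambda>u j. - P (f ^ j * u)) x (sign_parts \<epsilon>) = - P (walk cut_step f (f * x) \<epsilon>)" for x
  proof (induction \<epsilon> arbitrary: x rule: sign_parts.induct)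
    case (2 \<epsilon>)
    obtain j js where js: "sign_parts \<epsilon> = j # js" by (rule sign_parts_Cons)
    show ?case using 2[of "f * x"] by (simp add: js mult_ac)
  qed simp_all
  from this[of 1] show ?thesis by (simp add: nest_def foldl_conv_foldr)
qed

lemma cut_add: "cut_step (x + y) \<eta> = cut_step x \<eta> + cut_step y \<eta>"
  by (cases \<eta>) (simp_all add: add)

lemma walk_cut_add:
  "walk cut_step f (x + y) \<epsilon> = walk cut_step f x \<epsilon> + walk cut_step f y \<epsilon>"
  by (induction \<epsilon> arbitrary: x y) (simp_all add: cut_add distrib_left)

lemma proj_minus: "proj_step (- x) \<eta> = - proj_step x \<eta>"
  by (cases \<eta>) (simp_all add: minus)

lemma walk_proj_minus: "walk proj_step f (- x) \<epsilon> = - walk proj_step f x \<epsilon>"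
  by (induction \<epsilon> arbitrary: x) (simp_all add: proj_minus)

lemma finite_sign_le: "finite {\<epsilon>'. sign_le \<epsilon> \<epsilon>'}" "finite {\<epsilon>'. sign_le \<epsilon>' \<epsilon>}"
  by (rule finite_subset[OF _ finite_sign_lists[of "length \<epsilon>"]];
      auto simp: sign_le_def list_all2_lengthD)+

text \<open>
  A minus sign of \<open>\<epsilon>\<close> forces the step \<open>- P\<close>, hence one factor \<open>-1\<close>; at a plus sign both steps
  occur and add up to \<open>id - P\<close>.
\<close>
lemma sum_walk_cut:
  "(\<Sum>\<epsilon>' | sign_le \<epsilon> \<epsilon>'. walk cut_step f u \<epsilon>') = (-1) ^ count_list \<epsilon> Minus * walk proj_step f u \<epsilon>"
proof (induction \<epsilon> arbitrary: u rule: sign_parts.induct)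
  case 1
  then show ?case by (simp add: sign_le_def)
next
  case (2 \<epsilon>)
  have "{\<epsilon>'. sign_le (Plus # \<epsilon>) \<epsilon>'} =
      (#) Plus ` {\<epsilon>'. sign_le \<epsilon> \<epsilon>'} \<union> (#) Minus ` {\<epsilon>'. sign_le \<epsilon> \<epsilon>'}"
  proof (rule set_eqI)
    fix \<epsilon>'
    show "\<epsilon>' \<in> {\<epsilon>'. sign_le (Plus # \<epsilon>) \<epsilon>'} \<longleftrightarrow>
        \<epsilon>' \<in> (#) Plus ` {\<epsilon>'. sign_le \<epsilon> \<epsilon>'} \<union> (#) Minus ` {\<epsilon>'. sign_le \<epsilon> \<epsilon>'}"
    proof (cases \<epsilon>')
      case (Cons \<eta> \<epsilon>'')
      then show ?thesis by (cases \<eta>) (auto simp: sign_le_def)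
    qed (auto simp: sign_le_def)
  qed
  then have "(\<Sum>\<epsilon>' | sign_le (Plus # \<epsilon>) \<epsilon>'. walk cut_step f u \<epsilon>') =
      (\<Sum>\<epsilon>' | sign_le \<epsilon> \<epsilon>'. walk cut_step f (f * u) \<epsilon>') + (\<Sum>\<epsilon>' | sign_le \<epsilon> \<epsilon>'. walk cut_step f (f * - P u) \<epsilon>')"
    by (simp only:, subst sum.union_disjoint) (auto simp: finite_sign_le sum.reindex)
  also have "\<dots> = (\<Sum>\<epsilon>' | sign_le \<epsilon> \<epsilon>'. walk cut_step f (f * u + f * - P u) \<epsilon>')"
    by (simp only: walk_cut_add sum.distrib)
  also have "\<dots> = (-1) ^ count_list \<epsilon> Minus * walk proj_step f (f * u + f * - P u) \<epsilon>"
    by (rule 2)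
  finally show ?case
    by (simp add: right_diff_distrib)
next
  case (3 \<epsilon>)
  have "{\<epsilon>'. sign_le (Minus # \<epsilon>) \<epsilon>'} = (#) Minus ` {\<epsilon>'. sign_le \<epsilon> \<epsilon>'}"
    by (auto simp: sign_le_def list_all2_Cons1)
  then show ?case
    by (simp add: sum.reindex 3 walk_proj_minus)
qed

text \<open>
  This is \<open>primitive_nest\<close> with every \<open>S\<^sup>I\<close> expanded into ribbons and the double sum exchanged.
  The sign in \<open>sum_walk_cut\<close> is the one in the definition of \<open>R\<^sub>\<epsilon>\<^sub>\<bullet>\<close>.
\<close>
lemma primitive_sum_walk:
  fixes res :: "'a \<Rightarrow> real"
  assumes add_res: "\<And>x y. res (x + y) = res x + res y"
    and res_P: "\<And>x. res (P x) = res x"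
    and res_mult: "\<And>x y. res (P x * P y) = 0"
  shows "primitive (\<Sum>\<epsilon> | length \<epsilon> = n. res (walk proj_step f f \<epsilon>) *\<^sub>R ribbon_bullet \<epsilon>)"
proof -
  let ?L = "{\<epsilon>. length \<epsilon> = n}" and ?C = "sign_composition"
  \<comment> \<open>The sign makes up for the one in \<open>nest_sign_parts\<close>.\<close>
  define r where "r x = - res x" for x
  have res0: "res 0 = 0" using add_res[of 0 0] by simp
  have res_minus: "res (- x) = - res x" for x
    using add_res[of x "- x"] by (simp add: res0)
  have res_sum: "res (\<Sum>i\<in>A. h i) = (\<Sum>i\<in>A. res (h i))" for A and h :: "sign list \<Rightarrow> 'a"
    by (induction A rule: infinite_finite_induct) (simp_all add: res0 add_res)
  have res_sgn: "res ((-1) ^ k * x) = (-1) ^ k * res x" for k x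
    by (induction k) (simp_all add: res_minus)
  have "(\<Sum>J | weight J = n + 1. r (nest f (rev (parts J))) *\<^sub>R S_prod J)
      = (\<Sum>\<epsilon>\<in>?L. r (nest f (rev (parts (?C \<epsilon>)))) *\<^sub>R S_prod (?C \<epsilon>))"
    by (rule sum.reindex_bij_betw[OF bij_betw_sign_composition, symmetric])
  also have "\<dots> = (\<Sum>\<epsilon>\<in>?L. \<Sum>\<epsilon>' | sign_le \<epsilon>' \<epsilon>. res (walk cut_step f f \<epsilon>) *\<^sub>R ribbon (?C \<epsilon>'))"
    by (simp add: parts_sign_composition nest_sign_parts r_def res_minus res_P
        S_prod_sign_composition scaleR_sum_right)
  also have "\<dots> = (\<Sum>(\<epsilon>, \<epsilon>')\<in>(SIGMA \<epsilon>:?L. {\<epsilon>'. sign_le \<epsilon>' \<epsilon>}). res (walk cut_step f f \<epsilon>) *\<^sub>R ribbon (?C \<epsilon>'))"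
    by (rule sum.Sigma) (simp_all add: finite_sign_lists finite_sign_le)
  also have "\<dots> = (\<Sum>(\<epsilon>', \<epsilon>)\<in>(SIGMA \<epsilon>':?L. {\<epsilon>. sign_le \<epsilon>' \<epsilon>}). res (walk cut_step f f \<epsilon>) *\<^sub>R ribbon (?C \<epsilon>'))"
    by (rule sum.reindex_bij_witness[of _ prod.swap prod.swap])
      (auto simp: sign_le_def list_all2_lengthD dest: list_all2_lengthD)
  also have "\<dots> = (\<Sum>\<epsilon>'\<in>?L. \<Sum>\<epsilon> | sign_le \<epsilon>' \<epsilon>. res (walk cut_step f f \<epsilon>) *\<^sub>R ribbon (?C \<epsilon>'))"
    by (rule sum.Sigma[symmetric]) (simp_all add: finite_sign_lists finite_sign_le)
  also have "\<dots> = (\<Sum>\<epsilon>'\<in>?L. res (walk proj_step f f \<epsilon>') *\<^sub>R ribbon_bullet \<epsilon>')"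
    by (simp add: ribbon_bullet_eq sum_walk_cut res_sgn mult_ac flip: scaleR_sum_left res_sum)
  finally show ?thesis
    using primitive_nest[of r "n + 1" f] by (simp add: r_def add_res res_mult)
qed

end

section \<open>Two poles on the ring of Laurent series\<close>

unbundle fps_syntax

definition polar_part :: "real fls \<Rightarrow> real fls"
  where "polar_part f = f - fps_to_fls (fls_regpart f)"

lemma polar_part_nth [simp]: "polar_part f $$ n = (if n < 0 then f $$ n else 0)"
  by (simp add: polar_part_def)

text \<open>
  A product of two purely polar series has a pole of order at least two.  This makes the polar
  series a subring and makes the residue vanish on its products.
\<close>
lemma fls_times_nth_polar:
  fixes x y :: "real fls"
  assumes "\<And>n. n \<ge> 0 \<Longrightarrow> x $$ n = 0" "\<And>n. n \<ge> 0 \<Longrightarrow> y $$ n = 0" "n \<ge> -1"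
  shows "(x * y) $$ n = 0"
proof -
  have "x $$ i * y $$ (n - i) = 0" for i
    using assms by (cases "i \<ge> 0") auto
  then show ?thesis unfolding fls_times_nth(2) by (intro sum.neutral ballI)
qed

lemma rota_baxter_polar_part: "rota_baxter polar_part"
proof
  fix x y :: "real fls"
  show add: "polar_part (x + y) = polar_part x + polar_part y" for x y
    by (rule fls_eqI) simp
  have polar: "polar_part (polar_part x * polar_part y) = polar_part x * polar_part y"
    by (rule fls_eqI) (simp add: fls_times_nth_polar)
  have "(x - polar_part x) * (y - polar_part y) = fps_to_fls (fls_regpart x * fls_regpart y)"
    by (simp add: polar_part_def fls_times_fps_to_fls)
  then have regular: "polar_part ((x - polar_part x) * (y - polar_part y)) = 0"
    by (intro fls_eqI) simp
  \<comment> \<open>Write \<open>x y\<close> as \<open>e\<close> plus the product of the regular parts, which \<open>polar_part\<close> kills; \<open>e\<close> is the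
    part of \<open>x y\<close> with at least one polar factor.\<close>
  define e where "e = x * y - (x - polar_part x) * (y - polar_part y)"
  have "polar_part x * y + x * polar_part y = polar_part x * polar_part y + e"
    by (simp add: e_def algebra_simps)
  then have "polar_part (polar_part x * y) + polar_part (x * polar_part y)
      = polar_part x * polar_part y + polar_part e"
    by (metis add polar)
  moreover have "polar_part (x * y) = polar_part e"
    using add[of e "(x - polar_part x) * (y - polar_part y)"] regular by (simp add: e_def)
  ultimately show "polar_part x * polar_part y
      = polar_part (x * polar_part y) + polar_part (polar_part x * y) - polar_part (x * y)"
    by (simp add: eq_diff_eq add.commute)
qed

interpretation polar: rota_baxter polar_part
  by (rule rota_baxter_polar_part)

text \<open>
  \<open>1/(1 - y)\<close> is regular at \<open>y = 0\<close> and \<open>1/y\<close> is polar.  The substitution \<open>y \<mapsto> 1 - y\<close> exchanges them, so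
  the plus and the minus side can be treated alike.
\<close>
definition pole :: "sign \<Rightarrow> real fls"
  where "pole \<eta> = (case \<eta> of Plus \<Rightarrow> fps_to_fls (Abs_fps (\<lambda>_. 1)) | Minus \<Rightarrow> fls_X_inv)"

definition opp :: "sign \<Rightarrow> sign"
  where "opp \<eta> = (case \<eta> of Plus \<Rightarrow> Minus | Minus \<Rightarrow> Plus)"

lemma opp_simps [simp]: "opp Plus = Minus" "opp Minus = Plus" "opp (opp \<eta>) = \<eta>"
  by (cases \<eta>; simp add: opp_def)+

text \<open>The partial fraction decomposition of \<open>1/(y (1 - y))\<close>.\<close>
lemma pole_mult_pole_opp: "pole \<eta> * pole (opp \<eta>) = pole \<eta> + pole (opp \<eta>)"
proof -
  have "pole Plus * pole Minus = pole Plus + pole Minus"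
    by (rule fls_eqI) (auto simp: pole_def fls_X_inv_times_conv_shift)
  then show ?thesis by (cases \<eta>) (simp_all add: mult.commute add.commute)
qed

text \<open>
  The partial fraction decomposition of \<open>v w\<^sup>k\<close>.  The other pole \<open>v\<close> occurs in it with coefficient
  \<open>1\<close> for every \<open>k\<close>, which is the lack of memory.
\<close>
lemma pole_opp_mult_pole_power:
  "pole (opp \<eta>) * pole \<eta> ^ k = pole (opp \<eta>) + (\<Sum>i<k. pole \<eta> ^ Suc i)"
proof (induction k)
  case (Suc k)
  have "pole (opp \<eta>) * pole \<eta> ^ Suc k = pole \<eta> * (pole (opp \<eta>) * pole \<eta> ^ k)"
    by (simp add: mult_ac)
  also have "\<dots> = pole (opp \<eta>) + (pole \<eta> ^ Suc 0 + (\<Sum>i<k. pole \<eta> ^ Suc (Suc i)))"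
    by (simp add: Suc distrib_left pole_mult_pole_opp sum_distrib_left)
  also have "\<dots> = pole (opp \<eta>) + (\<Sum>i<Suc k. pole \<eta> ^ Suc i)"
    by (simp add: sum.lessThan_Suc_shift del: sum.lessThan_Suc)
  finally show ?case .
qed simp

lemma pole_Minus_power_nth: "pole Minus ^ k $$ n = (if n = - int k then 1 else 0)"
  by (simp add: pole_def)

lemma pole_Plus_power_nth: "n < 0 \<Longrightarrow> pole Plus ^ k $$ n = 0"
  by (simp add: pole_def flip: fps_to_fls_power)

abbreviation proj :: "real fls \<Rightarrow> sign \<Rightarrow> real fls"
  where "proj \<equiv> polar.proj_step"

lemma polar_part_const_mult: "polar_part (fls_const c * x) = fls_const c * polar_part x"
  by (rule fls_eqI) simp

lemma proj_add: "proj (x + y) \<eta> = proj x \<eta> + proj y \<eta>"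
  by (cases \<eta>) (simp_all add: polar.add)

lemma proj_const_mult: "proj (fls_const c * x) \<eta> = fls_const c * proj x \<eta>"
  by (cases \<eta>) (simp_all add: polar_part_const_mult right_diff_distrib)

lemma proj_sum: "proj (\<Sum>i<k. h i) \<eta> = (\<Sum>i<(k::nat). proj (h i) \<eta>)"
proof (induction k)
  case 0
  show ?case by (cases \<eta>) simp_all
qed (simp add: proj_add)

lemma polar_part_pole_power:
  "polar_part (pole Minus ^ Suc k) = pole Minus ^ Suc k" "polar_part (pole Plus ^ k) = 0"
proof -
  show "polar_part (pole Minus ^ Suc k) = pole Minus ^ Suc k"
    unfolding fls_eq_iff by (simp only: polar_part_nth pole_Minus_power_nth) auto
  show "polar_part (pole Plus ^ k) = 0"
    by (rule fls_eqI) (simp add: pole_Plus_power_nth)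
qed

lemma proj_pole_power:
  "proj (pole \<eta> ^ Suc k) \<eta> = pole \<eta> ^ Suc k" "proj (pole \<eta> ^ Suc k) (opp \<eta>) = 0"
  by (cases \<eta>; simp only: polar.step_simps opp_simps polar_part_pole_power diff_zero diff_self)+

lemmas proj_pole = proj_pole_power[where k = 0, unfolded power_Suc0_right]

lemma proj_pole_opp: "proj (pole (opp \<eta>)) \<eta> = 0"
  using proj_pole(2)[of "opp \<eta>"] by simp

definition sign_weight :: "real \<Rightarrow> real \<Rightarrow> sign \<Rightarrow> real"
  where "sign_weight a b \<eta> = (case \<eta> of Plus \<Rightarrow> a | Minus \<Rightarrow> b)"

lemma sign_weight_simps [simp]: "sign_weight a b Plus = a" "sign_weight a b Minus = b"
  by (simp_all add: sign_weight_def)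

section \<open>The walk within a stack\<close>

definition ca_fps :: "real \<Rightarrow> real \<Rightarrow> real fps"
  where "ca_fps a b = Abs_fps (\<lambda>n. ca n a b)"

text \<open>
  The functional equation \<open>C = t (1 + a C) (1 + b C)\<close>, with the factors in the order that is
  adapted to \<open>\<eta>\<close>.
\<close>
lemma ca_fps_eq:
  "ca_fps a b = fps_X * (1 + fps_const (sign_weight a b \<eta>) * ca_fps a b) * (1 + fps_const (sign_weight a b (opp \<eta>)) * ca_fps a b)"
proof -
  have "ca_fps a b = fps_X * (1 + fps_const (a + b) * ca_fps a b + fps_const (a * b) * (ca_fps a b * ca_fps a b))"
  proof (rule fps_ext)
    fix n show "ca_fps a b $ n = (fps_X * (1 + fps_const (a + b) * ca_fps a b
        + fps_const (a * b) * (ca_fps a b * ca_fps a b))) $ n"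
      by (cases n) (auto simp: ca_fps_def ca_Suc fps_mult_nth[of "Abs_fps _"] atLeast0AtMost
          simp del: fps_const_add fps_const_mult)
  qed
  also have "\<dots> = fps_X * (1 + fps_const a * ca_fps a b) * (1 + fps_const b * ca_fps a b)"
    by (simp add: algebra_simps flip: fps_const_add fps_const_mult)
  finally show ?thesis by (cases \<eta>) (simp_all add: mult_ac)
qed

text \<open>
  The solution of the recursion \<open>stack_fps_rec\<close>, which the steps of the walk within one stack obey.
  Differences in \<open>k\<close> reduce the recursion to a linear one of order two with constant coefficients,
  and \<open>1 + b C\<close> (for \<open>\<eta> = Plus\<close>) is the characteristic root that is a power series.
\<close>
definition stack_fps :: "real \<Rightarrow> real \<Rightarrow> sign \<Rightarrow> nat \<Rightarrow> real fps"
  where "stack_fps a b \<eta> k =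
    (1 + fps_const (sign_weight a b \<eta>) * ca_fps a b) * (1 + fps_const (sign_weight a b (opp \<eta>)) * ca_fps a b) ^ k"

lemma stack_fps_rec:
  "stack_fps a b \<eta> k = 1 + fps_X * (fps_const (sign_weight a b \<eta>) * stack_fps a b \<eta> (Suc k)
     + fps_const (sign_weight a b (opp \<eta>)) * (\<Sum>i<k. stack_fps a b \<eta> (Suc i)))"
proof -
  define A B C where "A = fps_const (sign_weight a b \<eta>)" and "B = fps_const (sign_weight a b (opp \<eta>))" and "C = ca_fps a b"
  have C: "fps_X * (1 + A * C) * (1 + B * C) = C"
    using ca_fps_eq[of a b \<eta>] by (simp add: A_def B_def C_def)
  have F: "stack_fps a b \<eta> i = (1 + A * C) * (1 + B * C) ^ i" for i
    by (simp add: stack_fps_def A_def B_def C_def)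
  have XF: "fps_X * stack_fps a b \<eta> (Suc i) = C * (1 + B * C) ^ i" for i
    using arg_cong[OF C, of "\<lambda>x. x * (1 + B * C) ^ i"] by (simp add: F mult_ac)
  have geom: "1 + B * (\<Sum>i<k. C * (1 + B * C) ^ i) = (1 + B * C) ^ k"
    by (induction k) (simp_all add: algebra_simps)
  have "1 + fps_X * (A * stack_fps a b \<eta> (Suc k) + B * (\<Sum>i<k. stack_fps a b \<eta> (Suc i)))
      = A * (fps_X * stack_fps a b \<eta> (Suc k)) + (1 + B * (\<Sum>i<k. fps_X * stack_fps a b \<eta> (Suc i)))"
    by (simp add: distrib_left mult_ac flip: sum_distrib_left)
  also have "\<dots> = stack_fps a b \<eta> k"
    unfolding XF geom by (simp add: F algebra_simps)
  finally show ?thesis by (simp add: A_def B_def)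
qed

lemma stack_fps_1_nth: "stack_fps a b \<eta> (Suc 0) $ n = ca (Suc n) a b"
proof -
  have "fps_X * stack_fps a b \<eta> (Suc 0) = ca_fps a b"
    using ca_fps_eq[of a b \<eta>] by (simp add: stack_fps_def mult_ac)
  from arg_cong[OF this, of "\<lambda>f. f $ Suc n"] show ?thesis by (simp add: ca_fps_def)
qed

text \<open>
  The multiplier of the walk.  Crossing to a side picks up the coefficient of its simple pole, so these
  coefficients are the weights of the stacks.
\<close>
definition kernel :: "real \<Rightarrow> real \<Rightarrow> real fls"
  where "kernel a b = fls_const a * pole Plus + fls_const b * pole Minus"

lemma kernel_eq: "kernel a b = fls_const (sign_weight a b \<eta>) * pole \<eta> + fls_const (sign_weight a b (opp \<eta>)) * pole (opp \<eta>)"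
  by (cases \<eta>) (simp_all add: kernel_def add.commute)

lemma kernel_mult_pole_power:
  "kernel a b * pole \<eta> ^ k = fls_const (sign_weight a b \<eta>) * pole \<eta> ^ Suc k
     + fls_const (sign_weight a b (opp \<eta>)) * (pole (opp \<eta>) + (\<Sum>i<k. pole \<eta> ^ Suc i))"
  unfolding kernel_eq[of a b \<eta>] pole_opp_mult_pole_power[symmetric]
  by (simp add: algebra_simps)

text \<open>One step of the walk that ends on the same side again.\<close>
definition stay :: "real \<Rightarrow> real \<Rightarrow> sign \<Rightarrow> real fls \<Rightarrow> real fls"
  where "stay a b \<eta> x = proj (kernel a b * x) \<eta>"

lemma stay_pole_power:
  "stay a b \<eta> (pole \<eta> ^ Suc k) = fls_const (sign_weight a b \<eta>) * pole \<eta> ^ Suc (Suc k)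
     + fls_const (sign_weight a b (opp \<eta>)) * (\<Sum>i<Suc k. pole \<eta> ^ Suc i)"
  unfolding stay_def kernel_mult_pole_power
  by (simp only: proj_add proj_const_mult proj_sum proj_pole_power proj_pole_opp add_0_left)

lemma stay_linear:
  "(stay a b \<eta> ^^ n) (x + y) = (stay a b \<eta> ^^ n) x + (stay a b \<eta> ^^ n) y"
  "(stay a b \<eta> ^^ n) (fls_const c * x) = fls_const c * (stay a b \<eta> ^^ n) x"
proof -
  have 1: "stay a b \<eta> (x + y) = stay a b \<eta> x + stay a b \<eta> y" for x y
    by (simp add: stay_def distrib_left proj_add)
  have 2: "stay a b \<eta> (fls_const c * x) = fls_const c * stay a b \<eta> x" for x
    by (simp add: stay_def proj_const_mult flip: mult.left_commute[of "fls_const c"])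
  show "(stay a b \<eta> ^^ n) (x + y) = (stay a b \<eta> ^^ n) x + (stay a b \<eta> ^^ n) y"
    by (induction n) (simp_all add: 1)
  show "(stay a b \<eta> ^^ n) (fls_const c * x) = fls_const c * (stay a b \<eta> ^^ n) x"
    by (induction n) (simp_all add: 2)
qed

text \<open>
  The form \<open>g\<close> stands for what happens when the stack is over: a coefficient of the projection to the
  other side, or the residue.  By the lack of memory each of these takes the same value \<open>c\<close> at all powers
  of the pole, and then so many steps inside the stack only contribute a coefficient of
  \<open>stack_fps\<close>.
\<close>
lemma linear_kernel_stay:
  fixes g :: "real fls \<Rightarrow> real"
  assumes add: "\<And>x y. g (x + y) = g x + g y"
    and const: "\<And>c x. g (fls_const c * x) = c * g x"
    and c: "\<And>k. g (kernel a b * pole \<eta> ^ Suc k) = c"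
  shows "g (kernel a b * (stay a b \<eta> ^^ n) (pole \<eta> ^ Suc k)) = c * stack_fps a b \<eta> (Suc k) $ n"
proof (induction n arbitrary: k)
  case 0
  show ?case using c[of k] by (subst stack_fps_rec) simp
next
  case (Suc n)
  define h where "h x = g (kernel a b * (stay a b \<eta> ^^ n) x)" for x
  have h_add: "h (x + y) = h x + h y" for x y
    by (simp add: h_def stay_linear distrib_left add)
  have h_const: "h (fls_const c * x) = c * h x" for c x
    by (simp add: h_def stay_linear const flip: mult.left_commute[of "fls_const c"])
  have h_sum: "h (\<Sum>i<m. y i) = (\<Sum>i<m. h (y i))" for y and m :: nat
    using h_const[of 0 0] by (induction m) (simp_all add: h_add)
  have "g (kernel a b * (stay a b \<eta> ^^ Suc n) (pole \<eta> ^ Suc k)) = h (stay a b \<eta> (pole \<eta> ^ Suc k))"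
    by (simp only: h_def funpow_Suc_right o_apply)
  also have "\<dots> = sign_weight a b \<eta> * h (pole \<eta> ^ Suc (Suc k)) + sign_weight a b (opp \<eta>) * (\<Sum>i<Suc k. h (pole \<eta> ^ Suc i))"
    by (simp only: stay_pole_power h_add h_const h_sum)
  also have "\<dots> = c * (sign_weight a b \<eta> * stack_fps a b \<eta> (Suc (Suc k)) $ n
      + sign_weight a b (opp \<eta>) * (\<Sum>i<Suc k. stack_fps a b \<eta> (Suc i) $ n))"
    unfolding h_def Suc by (simp only: sum_distrib_left[symmetric]) (simp add: algebra_simps)
  also have "\<dots> = c * stack_fps a b \<eta> (Suc k) $ Suc n"
    by (subst (3) stack_fps_rec) (simp add: fps_sum_nth)
  finally show ?case .
qed

section \<open>The residue as a product over the stacks\<close>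

lemma proj_kernel_crossing:
  "proj (kernel a b * pole \<eta> ^ Suc k) (opp \<eta>) = fls_const (sign_weight a b (opp \<eta>)) * pole (opp \<eta>)"
proof -
  have "proj (pole (opp \<eta>)) (opp \<eta>) = pole (opp \<eta>)" by (rule proj_pole(1))
  then show ?thesis
    unfolding kernel_mult_pole_power
    by (simp only: proj_add proj_const_mult proj_sum proj_pole_power) simp
qed

text \<open>
  On the plus side the residue sees the simple pole \<open>1/y\<close> produced by the product.  On the minus
  side \<open>b v\<^sup>k\<^sup>+\<^sup>2\<close> has no residue, and among the terms \<open>a v\<^sup>i\<close> only \<open>i = 1\<close> has one.
\<close>
lemma residue_kernel_pole_power: "(kernel a b * pole \<eta> ^ Suc k) $$ (-1) = sign_weight a b (opp \<eta>)"
proof (cases \<eta>)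
  case Plus
  have "pole Plus ^ Suc i $$ (-1) = 0" for i
    by (rule pole_Plus_power_nth) simp
  moreover have "pole Minus $$ (-1) = 1"
    using pole_Minus_power_nth[of 1] by simp
  ultimately show ?thesis
    unfolding kernel_mult_pole_power Plus
    by (simp add: fls_nth_sum del: power_Suc sum.lessThan_Suc)
next
  case Minus
  have "pole Plus $$ (-1) = 0"
    using pole_Plus_power_nth[of "-1" 1] by simp
  moreover have "pole Minus $$ (-1) = 1"
    using pole_Minus_power_nth[of 1] by simp
  ultimately show ?thesis
    unfolding kernel_mult_pole_power Minus
    by (simp add: pole_Minus_power_nth fls_nth_sum sum.lessThan_Suc_shift del: power_Suc sum.lessThan_Suc)
qed

lemma walk_replicate:
  "walk proj (kernel a b) (kernel a b * x) (replicate n \<eta>) = kernel a b * (stay a b \<eta> ^^ n) x"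
  by (induction n arbitrary: x) (simp_all add: funpow_swap1 flip: stay_def)

text \<open>The coefficient as a function of the list of stacks, in a form suited to induction.\<close>
fun stack_weight :: "real \<Rightarrow> real \<Rightarrow> (sign \<times> nat) list \<Rightarrow> real"
  where "stack_weight a b [] = 1"
  | "stack_weight a b [(\<eta>, k)] = ca k a b"
  | "stack_weight a b ((\<eta>, k) # s # ss) = sign_weight a b \<eta> * ca k a b * stack_weight a b (s # ss)"

lemma D_coeff_eq: "D_coeff a b \<epsilon> = stack_weight a b (stacks \<epsilon>)"
proof -
  have "(\<Prod>i\<in>{i. Suc i < length ss \<and> fst (ss ! i) = Plus}. a)
      * (\<Prod>i\<in>{i. Suc i < length ss \<and> fst (ss ! i) = Minus}. b)
      * (\<Prod>i<length ss. ca (snd (ss ! i)) a b) = stack_weight a b ss" for ss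
  proof -
    let ?A = "\<lambda>\<eta>. {i. Suc i < length ss \<and> fst (ss ! i) = \<eta>}"
    have "(\<Prod>i\<in>?A Plus. a) = (\<Prod>i\<in>?A Plus. sign_weight a b (fst (ss ! i)))"
      "(\<Prod>i\<in>?A Minus. b) = (\<Prod>i\<in>?A Minus. sign_weight a b (fst (ss ! i)))"
      by (intro prod.cong; simp)+
    moreover have "finite (?A \<eta>)" for \<eta>
      by (rule finite_subset[of _ "{..<length ss}"]) auto
    moreover have "?A Plus \<union> ?A Minus = {..<length ss - 1}"
    proof (rule set_eqI)
      fix i show "i \<in> ?A Plus \<union> ?A Minus \<longleftrightarrow> i \<in> {..<length ss - 1}"
        by (cases "fst (ss ! i)") (simp_all add: less_diff_conv)
    qed
    ultimately have "(\<Prod>i\<in>?A Plus. a) * (\<Prod>i\<in>?A Minus. b) = (\<Prod>i<length ss - 1. sign_weight a b (fst (ss ! i)))"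
      using prod.union_disjoint[of "?A Plus" "?A Minus" "\<lambda>i. sign_weight a b (fst (ss ! i))"]
      by (simp add: disjoint_iff)
    moreover have "(\<Prod>i<length ss - 1. sign_weight a b (fst (ss ! i))) * (\<Prod>i<length ss. ca (snd (ss ! i)) a b)
        = stack_weight a b ss"
      by (induction a b ss rule: stack_weight.induct)
        (simp_all add: prod.lessThan_Suc_shift del: prod.lessThan_Suc)
    ultimately show ?thesis by simp
  qed
  from this[of "stacks \<epsilon>"] show ?thesis by (simp add: D_coeff_def Let_def)
qed

text \<open>
  Arrival at a stack contributes the weight of its sign, the steps within it contribute \<open>ca\<close>, and the
  final residue contributes the weight opposite to the last sign.  In the coefficient of
  \<open>D\<^sub>a\<^sub>,\<^sub>b\<close> the last stack carries no weight, so the two weights at the end combine to the factor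
  \<open>a b\<close>.  The factor for the first sign is on the left because arrival at the first stack is
  accounted for by \<open>c\<close>.
\<close>
lemma residue_walk_stacks:
  assumes ab: "a \<noteq> 0" "b \<noteq> 0"
    and "distinct_adj (map fst ((\<eta>, k) # ss))" "\<And>\<eta>' k'. (\<eta>', k') \<in> set ((\<eta>, k) # ss) \<Longrightarrow> k' \<ge> 1"
    and "proj u \<eta> = fls_const c * pole \<eta>"
  shows "walk proj (kernel a b) u (concat (map (\<lambda>(\<eta>, k). replicate k \<eta>) ((\<eta>, k) # ss))) $$ (-1)
      * sign_weight a b \<eta> = c * (a * b) * stack_weight a b ((\<eta>, k) # ss)"
  using assms(3-)
proof (induction ss arbitrary: u \<eta> k c)
  case first: Nil
  then obtain m where m: "k = Suc m" by (cases k) auto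
  have "walk proj (kernel a b) u (replicate k \<eta>)
      = kernel a b * (stay a b \<eta> ^^ m) (fls_const c * pole \<eta> ^ Suc 0)"
    using first.prems(3) by (simp add: m walk_replicate)
  also have "\<dots> = fls_const c * (kernel a b * (stay a b \<eta> ^^ m) (pole \<eta> ^ Suc 0))"
    by (simp only: stay_linear mult.left_commute)
  also have "\<dots> $$ (-1) = c * (sign_weight a b (opp \<eta>) * ca k a b)"
    using linear_kernel_stay[of "\<lambda>x. x $$ (-1)" a b \<eta> "sign_weight a b (opp \<eta>)" m 0, OF _ _ residue_kernel_pole_power]
    by (simp add: stack_fps_1_nth m)
  finally show ?case by (cases \<eta>) simp_all
next
  case (Cons s ss)
  obtain \<eta>' k' where s: "s = (\<eta>', k')" by (cases s)
  have \<eta>': "\<eta>' = opp \<eta>"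
    using Cons.prems(1) s by (cases \<eta>; cases \<eta>') auto
  obtain m where m: "k = Suc m" using Cons.prems(2)[of \<eta> k] by (cases k) auto
  define u' where "u' = walk proj (kernel a b) u (replicate k \<eta>)"
  have u': "u' = fls_const c * (kernel a b * (stay a b \<eta> ^^ m) (pole \<eta> ^ Suc 0))"
  proof -
    have "u' = kernel a b * (stay a b \<eta> ^^ m) (fls_const c * pole \<eta> ^ Suc 0)"
      using Cons.prems(3) by (simp add: u'_def m walk_replicate)
    then show ?thesis by (simp only: stay_linear mult.left_commute)
  qed
  have proj_u': "proj u' \<eta>' = fls_const (c * ca k a b * sign_weight a b \<eta>') * pole \<eta>'"
  proof (rule fls_eqI)
    fix n
    have "proj (kernel a b * pole \<eta> ^ Suc j) \<eta>' $$ n = sign_weight a b \<eta>' * pole \<eta>' $$ n" for j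
      by (simp add: \<eta>' proj_kernel_crossing del: power_Suc)
    from linear_kernel_stay[of "\<lambda>x. proj x \<eta>' $$ n" a b \<eta> _ m 0, OF _ _ this]
    show "proj u' \<eta>' $$ n = (fls_const (c * ca k a b * sign_weight a b \<eta>') * pole \<eta>') $$ n"
      by (simp add: u' proj_add proj_const_mult stack_fps_1_nth m)
  qed
  have adj: "distinct_adj (map fst ((\<eta>', k') # ss))"
    using Cons.prems(1) s by (auto dest: distinct_adj_ConsD)
  have pos: "k'' \<ge> 1" if "(\<eta>'', k'') \<in> set ((\<eta>', k') # ss)" for \<eta>'' k''
    using Cons.prems(2)[of \<eta>'' k''] that s by simp
  have "walk proj (kernel a b) u' (concat (map (\<lambda>(\<eta>, k). replicate k \<eta>) (s # ss))) $$ (-1)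
      * sign_weight a b \<eta>' = c * ca k a b * sign_weight a b \<eta>' * (a * b) * stack_weight a b (s # ss)"
    unfolding s by (rule Cons.IH[OF adj pos proj_u'])
  \<comment> \<open>The weight on the left now belongs to \<open>\<eta>'\<close>; it cancels against arrival at \<open>\<eta>'\<close>, to make
    room for the weight of \<open>\<eta>\<close>, which the stack of \<open>\<eta>\<close> carries as a stack that is not the last.\<close>
  moreover have "sign_weight a b \<eta>' \<noteq> 0" using ab by (cases \<eta>') simp_all
  ultimately have "walk proj (kernel a b) u' (concat (map (\<lambda>(\<eta>, k). replicate k \<eta>) (s # ss))) $$ (-1)
      = c * ca k a b * (a * b) * stack_weight a b (s # ss)"
    by (simp add: mult_ac)
  then show ?case
    by (simp add: walk_append u'_def)
qed

lemma residue_walk: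
  assumes "a \<noteq> 0" "b \<noteq> 0" "\<epsilon> \<noteq> []"
  shows "walk proj (kernel a b) (kernel a b) \<epsilon> $$ (-1) = a * b * D_coeff a b \<epsilon>"
proof -
  obtain \<eta> k ss where ss: "stacks \<epsilon> = (\<eta>, k) # ss"
    using concat_stacks[of \<epsilon>] assms(3) by (cases "stacks \<epsilon>") auto
  have "proj (kernel a b) \<eta> = fls_const (sign_weight a b \<eta>) * pole \<eta>"
    by (simp add: kernel_eq[of a b \<eta>] proj_add proj_const_mult proj_pole proj_pole_opp)
  from residue_walk_stacks[OF assms(1,2) _ _ this, of k ss]
  have "walk proj (kernel a b) (kernel a b) \<epsilon> $$ (-1) * sign_weight a b \<eta>
      = sign_weight a b \<eta> * (a * b) * D_coeff a b \<epsilon>"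
    using distinct_adj_stacks[of \<epsilon>] stacks_pos[of _ _ \<epsilon>] concat_stacks[of \<epsilon>]
    unfolding ss D_coeff_eq by simp
  moreover have "sign_weight a b \<eta> \<noteq> 0" using assms by (cases \<eta>) simp_all
  ultimately show ?thesis by simp
qed

section \<open>Primitivity\<close>

lemma primitive_scaleR_iff:
  assumes "c \<noteq> 0"
  shows "primitive (c *\<^sub>R f) \<longleftrightarrow> primitive f"
  unfolding primitive_def
  by (simp only: Delta_scaleR tensor_scaleR_left tensor_scaleR_right scaleR_add_right[symmetric])
    (simp add: assms)

lemma primitive_D_elem_nonzero:
  assumes "a \<noteq> 0" "b \<noteq> 0" "n \<ge> 1"
  shows "primitive (D_elem a b n)"
proof -
  have "primitive (\<Sum>\<epsilon> | length \<epsilon> = n.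
      (walk proj (kernel a b) (kernel a b) \<epsilon> $$ (-1)) *\<^sub>R ribbon_bullet \<epsilon>)"
    by (rule polar.primitive_sum_walk) (simp_all add: fls_times_nth_polar)
  also have "(\<Sum>\<epsilon> | length \<epsilon> = n.
      (walk proj (kernel a b) (kernel a b) \<epsilon> $$ (-1)) *\<^sub>R ribbon_bullet \<epsilon>) = (a * b) *\<^sub>R D_elem a b n"
    unfolding D_elem_def scaleR_sum_right
  proof (rule sum.cong)
    fix \<epsilon> :: "sign list" assume "\<epsilon> \<in> {\<epsilon>. length \<epsilon> = n}"
    then have "\<epsilon> \<noteq> []" using assms(3) by auto
    then show "(walk proj (kernel a b) (kernel a b) \<epsilon> $$ (-1)) *\<^sub>R ribbon_bullet \<epsilon>
        = (a * b) *\<^sub>R D_coeff a b \<epsilon> *\<^sub>R ribbon_bullet \<epsilon>"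
      by (simp add: residue_walk assms)
  qed simp
  finally show ?thesis
    using assms by (simp add: primitive_scaleR_iff)
qed

text \<open>
  To reach the parameters with \<open>a b = 0\<close> one approaches \<open>(a, b)\<close> along the diagonal \<open>(a + s, b + s)\<close>, on
  which \<open>(a + s) (b + s)\<close> vanishes for at most two values of \<open>s\<close>.
\<close>
lemma continuous_on_ca:
  "continuous_on UNIV (\<lambda>s. ca n (a + s) (b + s))"
proof (induction n rule: less_induct)
  case (less n)
  then show ?case
    by (cases n) (auto simp: ca_Suc intro!: continuous_intros)
qed

lemma continuous_on_D_coeff:
  "continuous_on UNIV (\<lambda>s. D_coeff (a + s) (b + s) \<epsilon>)"
  unfolding D_coeff_def Let_def by (intro continuous_intros continuous_on_ca)

lemma primitive_D_elem:
  assumes "n \<ge> 1"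
  shows "primitive (D_elem a b n)"
proof -
  define defect where "defect f = Delta f - f \<otimes> 1 - 1 \<otimes> f" for f
  have defect_iff: "primitive f \<longleftrightarrow> defect f = 0" for f
    by (auto simp: primitive_def defect_def algebra_simps)
  have defect_lin: "defect (\<Sum>\<epsilon>\<in>A. c \<epsilon> *\<^sub>R h \<epsilon>) = (\<Sum>\<epsilon>\<in>A. c \<epsilon> *\<^sub>R defect (h \<epsilon>))"
    for A and c :: "sign list \<Rightarrow> real" and h
  proof -
    have "defect (f + g) = defect f + defect g" "defect (r *\<^sub>R f) = r *\<^sub>R defect f" "defect 0 = 0" for f g r
      by (simp_all add: defect_def Delta_add Delta_scaleR tensor_add_left tensor_add_right
          tensor_scaleR_left tensor_scaleR_right scaleR_diff_right)
    then show ?thesis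
      by (induction A rule: infinite_finite_induct) simp_all
  qed
  have "defect (D_elem a b n) = 0"
  proof (rule poly_mapping_eqI)
    fix p
    define G where "G s = Poly_Mapping.lookup (defect (D_elem (a + s) (b + s) n)) p" for s
    have "G = (\<lambda>s. \<Sum>\<epsilon> | length \<epsilon> = n. D_coeff (a + s) (b + s) \<epsilon> * Poly_Mapping.lookup (defect (ribbon_bullet \<epsilon>)) p)"
      by (simp add: fun_eq_iff G_def D_elem_def defect_lin lookup_sum lookup_scaleR)
    then have "continuous_on UNIV G"
      by (simp only:) (intro continuous_intros continuous_on_D_coeff)
    then have "(G \<longlongrightarrow> G 0) (at 0)"
      by (simp add: continuous_on_eq_continuous_at isContD)
    moreover have "(G \<longlongrightarrow> 0) (at 0)"
    proof (rule tendsto_eventually)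
      have "\<forall>\<^sub>F s in at 0. s \<notin> {- a, - b}"
      proof -
        have "open (- ({- a, - b} - {0}))" by (intro open_Compl finite_imp_closed) simp
        then have "\<forall>\<^sub>F s in at 0. s \<in> - ({- a, - b} - {0})"
          by (rule eventually_at_in_open') simp
        moreover have "\<forall>\<^sub>F s in at (0::real). s \<noteq> 0"
          by (simp add: eventually_at_filter)
        ultimately show ?thesis by eventually_elim auto
      qed
      then show "\<forall>\<^sub>F s in at 0. G s = 0"
      proof eventually_elim
        case (elim s)
        then have "primitive (D_elem (a + s) (b + s) n)"
          using assms by (intro primitive_D_elem_nonzero) auto
        then show ?case by (simp add: G_def defect_iff)
      qed
    qed
    ultimately have "G 0 = 0"
      by (rule tendsto_unique[rotated]) simp
    then show "Poly_Mapping.lookup (defect (D_elem a b n)) p = Poly_Mapping.lookup 0 p"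
      by (simp add: G_def)
  qed
  then show ?thesis by (simp add: defect_iff)
qed

section \<open>Homogeneity\<close>

lemma Sym_comp_iff: "f \<in> Sym_comp n \<longleftrightarrow> (\<forall>I. weight I \<noteq> n \<longrightarrow> Poly_Mapping.lookup f I = 0)"
  by (auto simp: Sym_comp_def in_keys_iff)

lemma Sym_comp_closed:
  "0 \<in> Sym_comp n"
  "f \<in> Sym_comp n \<Longrightarrow> g \<in> Sym_comp n \<Longrightarrow> f + g \<in> Sym_comp n"
  "f \<in> Sym_comp n \<Longrightarrow> g \<in> Sym_comp n \<Longrightarrow> f - g \<in> Sym_comp n"
  "f \<in> Sym_comp n \<Longrightarrow> c *\<^sub>R f \<in> Sym_comp n"
  by (simp_all add: Sym_comp_iff lookup_add lookup_minus lookup_scaleR)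

lemma Sym_comp_sum: "(\<And>i. i \<in> A \<Longrightarrow> h i \<in> Sym_comp n) \<Longrightarrow> (\<Sum>i\<in>A. h i) \<in> Sym_comp n"
  by (induction A rule: infinite_finite_induct) (simp_all add: Sym_comp_closed)

lemma ribbon_in_Sym_comp: "ribbon I \<in> Sym_comp (weight I)"
proof (induction I rule: ribbon.induct)
  case (1 I)
  have "S_prod I \<in> Sym_comp (weight I)"
    by (simp add: S_prod_eq_single Sym_comp_def)
  moreover have "(\<Sum>J\<in>{J. J \<preceq> I \<and> J \<noteq> I}. ribbon J) \<in> Sym_comp (weight I)"
  proof (rule Sym_comp_sum)
    fix J assume J: "J \<in> {J. J \<preceq> I \<and> J \<noteq> I}"
    then have "weight J = weight I" by (simp add: coarser_def)
    with 1[OF J] show "ribbon J \<in> Sym_comp (weight I)" by simp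
  qed
  ultimately show ?case
    by (subst ribbon.simps) (rule Sym_comp_closed)
qed

theorem theorem10p1:
  fixes a b :: real and n :: nat
  assumes "n \<ge> 1"
  shows "D_elem a b n \<in> Sym_comp (n + 1) \<and> primitive (D_elem a b n)"
proof
  have "ribbon_bullet \<epsilon> \<in> Sym_comp (n + 1)" if "length \<epsilon> = n" for \<epsilon>
    using ribbon_in_Sym_comp[of "sign_composition \<epsilon>"] that
    by (simp add: ribbon_bullet_eq sign_composition Sym_comp_closed)
  then show "D_elem a b n \<in> Sym_comp (n + 1)"
    unfolding D_elem_def by (intro Sym_comp_sum Sym_comp_closed) simp
  show "primitive (D_elem a b n)"
    using assms by (rule primitive_D_elem)
qed

end
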